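(* Let $G$ be a spider forest such that the length of each leg of every spider (component) of $G$ is either $1$ or even. Then $G$ is $k$-shifted antimagic for every integer $k \geq 0$.
   Context: All graphs are finite, simple, and undirected. For integers $a \le b$, $[a,b]=\{x\in\mathbb{Z}: a\le x\le b\}$. A spider is a tree with exactly one vertex of degree greater than two; that vertex is called its center. A leg of a spider is a path connecting its center to a leaf (degree-one vertex); the length of a leg is the number of edges on that path. A spider forest is a graph (possibly disconnected) each of whose connected components is a spider. Let $G=(V,E)$ be a graph with $m$ edges and let $k$ be an integer (possibly negative). For a bijection $f:E\to[k+1,k+m]$, the vertex-sum of $v\in V$ is $\phi_f(v)=\sum_{e\ni v} f(e)$, the sum of the labels of the edges incident to $v$. The bijection $f$ is a $k$-shifted antimagic labeling if $\phi_f(u)\neq\phi_f(v)$ for all distinct vertices $u,v\in V$. The graph $G$ is $k$-shifted antimagic if it admits a $k$-shifted antimagic labeling. *)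

theory Defs
  imports Main
begin

text \<open>
  A graph is given by its vertex set \<open>V\<close> and its edge set \<open>E\<close>; an undirected edge is a
  two-element set of vertices.
\<close>

definition simple_graph :: "'a set \<Rightarrow> 'a set set \<Rightarrow> bool" where
  "simple_graph V E \<longleftrightarrow> finite V \<and> (\<forall>e\<in>E. e \<subseteq> V \<and> card e = 2)"

definition degree :: "'a set set \<Rightarrow> 'a \<Rightarrow> nat" where
  "degree E v = card {e \<in> E. v \<in> e}"

text \<open>Walks, paths and cycles are represented by their lists of vertices.\<close>

definition is_walk :: "'a set \<Rightarrow> 'a set set \<Rightarrow> 'a list \<Rightarrow> bool" where
  "is_walk V E p \<longleftrightarrow> p \<noteq> [] \<and> set p \<subseteq> V \<and> successively (\<lambda>u v. {u, v} \<in> E) p"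

definition is_path :: "'a set \<Rightarrow> 'a set set \<Rightarrow> 'a list \<Rightarrow> bool" where
  "is_path V E p \<longleftrightarrow> is_walk V E p \<and> distinct p"

text \<open>The number of edges, one less than the number of vertices.\<close>

definition path_length :: "'a list \<Rightarrow> nat" where
  "path_length p = length p - 1"

text \<open>The closing vertex of a cycle is not repeated at the end of the list.\<close>

definition is_cycle :: "'a set \<Rightarrow> 'a set set \<Rightarrow> 'a list \<Rightarrow> bool" where
  "is_cycle V E p \<longleftrightarrow> is_path V E p \<and> 3 \<le> length p \<and> {last p, hd p} \<in> E"

definition reachable :: "'a set \<Rightarrow> 'a set set \<Rightarrow> 'a \<Rightarrow> 'a \<Rightarrow> bool" where
  "reachable V E u v \<longleftrightarrow> (\<exists>p. is_walk V E p \<and> hd p = u \<and> last p = v)"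

definition connected_graph :: "'a set \<Rightarrow> 'a set set \<Rightarrow> bool" where
  "connected_graph V E \<longleftrightarrow> V \<noteq> {} \<and> (\<forall>u\<in>V. \<forall>v\<in>V. reachable V E u v)"

definition is_tree :: "'a set \<Rightarrow> 'a set set \<Rightarrow> bool" where
  "is_tree V E \<longleftrightarrow> simple_graph V E \<and> connected_graph V E \<and> (\<nexists>p. is_cycle V E p)"

text \<open>
  A connected component is represented by its vertex set \<open>C\<close>; as a graph it is the pair of
  \<open>C\<close> and \<open>induced_edges E C\<close>.
\<close>

definition components :: "'a set \<Rightarrow> 'a set set \<Rightarrow> 'a set set" where
  "components V E = {{u. reachable V E v u} | v. v \<in> V}"

definition induced_edges :: "'a set set \<Rightarrow> 'a set \<Rightarrow> 'a set set" where
  "induced_edges E C = {e \<in> E. e \<subseteq> C}"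

definition is_spider :: "'a set \<Rightarrow> 'a set set \<Rightarrow> bool" where
  "is_spider V E \<longleftrightarrow> is_tree V E \<and> (\<exists>!c. c \<in> V \<and> 2 < degree E c)"

definition is_center :: "'a set \<Rightarrow> 'a set set \<Rightarrow> 'a \<Rightarrow> bool" where
  "is_center V E c \<longleftrightarrow> is_spider V E \<and> c \<in> V \<and> 2 < degree E c"

definition is_leaf :: "'a set \<Rightarrow> 'a set set \<Rightarrow> 'a \<Rightarrow> bool" where
  "is_leaf V E v \<longleftrightarrow> v \<in> V \<and> degree E v = 1"

definition is_leg :: "'a set \<Rightarrow> 'a set set \<Rightarrow> 'a list \<Rightarrow> bool" where
  "is_leg V E p \<longleftrightarrow> is_path V E p \<and> is_center V E (hd p) \<and> is_leaf V E (last p)"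

definition is_spider_forest :: "'a set \<Rightarrow> 'a set set \<Rightarrow> bool" where
  "is_spider_forest V E \<longleftrightarrow>
     simple_graph V E \<and> (\<forall>C \<in> components V E. is_spider C (induced_edges E C))"

definition vertex_sum :: "'a set set \<Rightarrow> ('a set \<Rightarrow> int) \<Rightarrow> 'a \<Rightarrow> int" where
  "vertex_sum E f v = (\<Sum>e | e \<in> E \<and> v \<in> e. f e)"

definition is_shifted_antimagic_labeling ::
  "'a set \<Rightarrow> 'a set set \<Rightarrow> int \<Rightarrow> ('a set \<Rightarrow> int) \<Rightarrow> bool" where
  "is_shifted_antimagic_labeling V E k f \<longleftrightarrow>
     bij_betw f E {k + 1 .. k + int (card E)} \<and>
     (\<forall>u\<in>V. \<forall>v\<in>V. u \<noteq> v \<longrightarrow> vertex_sum E f u \<noteq> vertex_sum E f v)"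

definition shifted_antimagic :: "'a set \<Rightarrow> 'a set set \<Rightarrow> int \<Rightarrow> bool" where
  "shifted_antimagic V E k \<longleftrightarrow> (\<exists>f. is_shifted_antimagic_labeling V E k f)"

end

theory Submission
  imports Defs "HOL-Library.Sublist"
begin

text \<open>
  Let \<open>2L\<close> be the number of edges on the even legs and \<open>T\<close> the number of legs of length 1.
  The \<open>L\<close> largest labels are \<open>large\<close>; of the others, \<open>T\<close> go to the legs of length 1 and the
  remaining \<open>L\<close> are \<open>small\<close>. Line up the even legs one after another, each traversed from its
  leaf to its center, and label their edges alternately with the small and the large labels, both
  in increasing order. Then leaves carry labels that are not large, the sums at the vertices of
  degree 2 increase along the line, and every edge of an even leg at a center is large. It remains
  to make the center sums distinct and larger than all others.

  Centers with at least two even legs get distinct sums, no two of them consecutive: reserve two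
  even legs at each, sort the centers by the sum of their other labels, and put the reserved legs
  last in the line, in two rounds that both follow this order. Every other center has at least two
  legs of length 1, one of which is reserved. Treating these centers in decreasing order of the sum
  of their other labels, give the reserved edges decreasing labels, passing over a label when it
  would produce one of the sums of the first kind of centers. Since those are not consecutive, each
  center passes over at most one label, and stars with three edges none; the labels passed over
  become small. The count of legs of length 1 shows that the sums stay large enough.
\<close>

section \<open>Choosing labels and orders\<close>

lemma sorted_enumeration:
  fixes w :: "'c \<Rightarrow> int"
  assumes "finite N"
  shows "\<exists>j::'c \<Rightarrow> nat. inj_on j N \<and> j ` N \<subseteq> {..<card N} \<and>
           (\<forall>c\<in>N. \<forall>d\<in>N. j c < j d \<longrightarrow> w c \<le> w d)"
  using assms
proof (induction "card N" arbitrary: N)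
  case 0
  then show ?case by simp
next
  case (Suc n)
  then have "N \<noteq> {}" by auto
  then obtain m where m: "m \<in> N" "\<And>c. c \<in> N \<Longrightarrow> w c \<le> w m"
    using obtains_MAX[of N w] Suc.prems by (metis Max_ge finite_imageI imageI)
  have cN: "card (N - {m}) = n" using Suc m by simp
  obtain j :: "'c \<Rightarrow> nat" where j: "inj_on j (N - {m})" "j ` (N - {m}) \<subseteq> {..<n}"
    "\<forall>c\<in>N - {m}. \<forall>d\<in>N - {m}. j c < j d \<longrightarrow> w c \<le> w d"
    using Suc.hyps(1)[of "N - {m}"] cN Suc.prems by auto
  let ?j = "j(m := n)"
  have "inj_on ?j N"
  proof (rule inj_onI)
    fix x y assume "x \<in> N" "y \<in> N" "?j x = ?j y"
    then show "x = y" using j(1,2) by (auto simp: inj_on_def split: if_splits)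
  qed
  moreover have "?j ` N \<subseteq> {..<card N}"
    using j(2) Suc.hyps(2) by (auto simp: less_Suc_eq)
  moreover have "\<forall>c\<in>N. \<forall>d\<in>N. ?j c < ?j d \<longrightarrow> w c \<le> w d"
    using j(2,3) m by (auto simp: less_Suc_eq)
  ultimately show ?case by blast
qed

text \<open>
  The values \<open>w c + x c\<close> decrease during the greedy choice, so each element of \<open>F\<close> is hit at most
  once: this gives the first lower bound on \<open>x\<close>. The second one holds because \<open>F\<close> contains no two
  consecutive integers, so that each \<open>c\<close> is hit at most once.
\<close>

lemma greedy_avoiding_sums:
  fixes w :: "'c \<Rightarrow> int" and u :: int
  assumes "finite H" "finite F" "D \<subseteq> H"
    and "\<And>v. v \<in> F \<Longrightarrow> v - 1 \<notin> F"
    and "\<And>c t. c \<in> H - D \<Longrightarrow> t \<le> u \<Longrightarrow> w c + t \<notin> F"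
  shows "\<exists>x. inj_on x H \<and> inj_on (\<lambda>c. w c + x c) H \<and>
           (\<forall>c\<in>H. w c + x c \<notin> F \<and> x c \<le> u \<and>
              u + 1 - int (card H) - int (card F) \<le> x c \<and>
              u + 1 - int (card H) - int (card D) \<le> x c)"
  using assms
proof (induction "card H" arbitrary: H F D u)
  case 0
  then show ?case by simp
next
  case (Suc n)
  \<comment> \<open>The element \<open>m\<close> with the largest \<open>w\<close> is treated first.
    All others get smaller values than \<open>m\<close>, so its sum exceeds all later ones and the
    sums come out distinct.\<close>
  then have "H \<noteq> {}" by auto
  then obtain m where m: "m \<in> H" "\<And>c. c \<in> H \<Longrightarrow> w c \<le> w m"
    using obtains_MAX[of H w] Suc.prems by (metis Max_ge finite_imageI imageI)
  have cH: "card (H - {m}) = n" "card H = Suc n" using Suc m by simp_all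
  have fD: "finite D" using Suc.prems finite_subset by blast
  have cD: "card (D - {m}) \<le> card D" using fD by (simp add: card_mono)
  show ?case
  proof (cases "w m + u \<in> F")
    case False
    obtain x where x: "inj_on x (H - {m})" "inj_on (\<lambda>c. w c + x c) (H - {m})"
      "\<forall>c\<in>H - {m}. w c + x c \<notin> F \<and> x c \<le> u - 1 \<and>
         (u - 1) + 1 - int n - int (card F) \<le> x c \<and>
         (u - 1) + 1 - int n - int (card (D - {m})) \<le> x c"
    proof -
      have "\<And>c t. c \<in> H - {m} - (D - {m}) \<Longrightarrow> t \<le> u - 1 \<Longrightarrow> w c + t \<notin> F" "D - {m} \<subseteq> H - {m}"
        using Suc.prems(3,5) by auto
      from Suc.hyps(1)[OF cH(1)[symmetric] _ Suc.prems(2) this(2) Suc.prems(4) this(1)]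
      show ?thesis using that Suc.prems(1) cH(1) by blast
    qed
    let ?x = "x(m := u)"
    have xr: "w c + x c \<notin> F" "x c \<le> u - 1" "u - int n - int (card F) \<le> x c"
        "u - int n - int (card (D - {m})) \<le> x c" if "c \<in> H" "c \<noteq> m" for c
      using x(3) that by auto
    have lt: "w c + ?x c < w m + ?x m" if "c \<in> H" "c \<noteq> m" for c
      using that xr(2)[OF that] m(2)[of c] by simp
    have "inj_on ?x H"
    proof (rule inj_onI)
      fix a b assume "a \<in> H" "b \<in> H" "?x a = ?x b"
      then show "a = b" using xr[of a] xr[of b] x(1)
        by (cases "a = m"; cases "b = m") (auto simp: inj_on_def)
    qed
    moreover have "inj_on (\<lambda>c. w c + ?x c) H"
    proof (rule inj_onI)
      fix a b assume ab: "a \<in> H" "b \<in> H" "w a + ?x a = w b + ?x b"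
      then show "a = b" using lt[of a] lt[of b] x(2)
        by (cases "a = m"; cases "b = m") (auto simp: inj_on_def)
    qed
    moreover have "w c + ?x c \<notin> F \<and> ?x c \<le> u \<and>
              u + 1 - int (card H) - int (card F) \<le> ?x c \<and>
              u + 1 - int (card H) - int (card D) \<le> ?x c" if "c \<in> H" for c
      using xr[of c] that False cH(2) cD by (cases "c = m") auto
    ultimately show ?thesis by blast
  next
    case True
    \<comment> \<open>Outside \<open>D\<close>, values up to \<open>u\<close> never lead into
      \<open>F\<close>, so a hit can only occur at an element of \<open>D\<close>.\<close>
    then have mD: "m \<in> D" using Suc.prems(5)[of m u] m by auto
    have cD1: "card D = Suc (card (D - {m}))" using mD fD by (metis card.remove)
    let ?v = "w m + u"
    have cF1: "card F = Suc (card (F - {?v}))" using True Suc.prems(2) by (metis card.remove)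
    obtain x where x: "inj_on x (H - {m})" "inj_on (\<lambda>c. w c + x c) (H - {m})"
      "\<forall>c\<in>H - {m}. w c + x c \<notin> F - {?v} \<and> x c \<le> u - 2 \<and>
         (u - 2) + 1 - int n - int (card (F - {?v})) \<le> x c \<and>
         (u - 2) + 1 - int n - int (card (D - {m})) \<le> x c"
    proof -
      have "\<And>c t. c \<in> H - {m} - (D - {m}) \<Longrightarrow> t \<le> u - 2 \<Longrightarrow> w c + t \<notin> F - {?v}"
        "D - {m} \<subseteq> H - {m}" "finite (F - {?v})" "\<And>v. v \<in> F - {?v} \<Longrightarrow> v - 1 \<notin> F - {?v}"
        using Suc.prems(2-5) by auto
      from Suc.hyps(1)[OF cH(1)[symmetric] _ this(3) this(2) this(4) this(1)]
      show ?thesis using that Suc.prems(1) cH(1) by blast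
    qed
    let ?x = "x(m := u - 1)"
    have xr: "w c + x c \<notin> F - {?v}" "x c \<le> u - 2" "u - 1 - int n - int (card (F - {?v})) \<le> x c"
        "u - 1 - int n - int (card (D - {m})) \<le> x c" if "c \<in> H" "c \<noteq> m" for c
      using x(3) that by auto
    have lt: "w c + ?x c < w m + ?x m" if "c \<in> H" "c \<noteq> m" for c
      using that xr(2)[OF that] m(2)[of c] by simp
    have "inj_on ?x H"
    proof (rule inj_onI)
      fix a b assume "a \<in> H" "b \<in> H" "?x a = ?x b"
      then show "a = b" using xr[of a] xr[of b] x(1)
        by (cases "a = m"; cases "b = m") (auto simp: inj_on_def)
    qed
    moreover have "inj_on (\<lambda>c. w c + ?x c) H"
    proof (rule inj_onI)
      fix a b assume ab: "a \<in> H" "b \<in> H" "w a + ?x a = w b + ?x b"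
      then show "a = b" using lt[of a] lt[of b] x(2)
        by (cases "a = m"; cases "b = m") (auto simp: inj_on_def)
    qed
    moreover have "w c + ?x c \<notin> F" if "c \<in> H" for c
    proof (cases "c = m")
      case True
      \<comment> \<open>The new sum of \<open>m\<close> is \<open>?v - 1\<close>, which is not in
        \<open>F\<close> because \<open>F\<close> has no two consecutive members.\<close>
      then show ?thesis using Suc.prems(4)[OF \<open>?v \<in> F\<close>] by (simp add: algebra_simps)
    next
      case False
      then show ?thesis using xr(1)[of c] xr(2)[of c] m(2)[of c] that by auto
    qed
    moreover have "?x c \<le> u \<and> u + 1 - int (card H) - int (card F) \<le> ?x c \<and>
              u + 1 - int (card H) - int (card D) \<le> ?x c" if "c \<in> H" for c
      using xr[of c] that cH(2) cD1 cF1 by (cases "c = m") auto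
    ultimately show ?thesis by blast
  qed
qed

section \<open>Labels of the unreserved legs of length 1\<close>

text \<open>Here \<open>\<rho> c\<close> is the reserved leg at \<open>c\<close>, and
  \<open>P\<close> will be the set of centers of stars. The top \<open>2 * card P\<close> labels are
  matched into pairs of equal sum, one pair for each star. So every star has two labels of known,
  large total, and for a star with three edges this fixes the sum apart from the reserved edge. The
  labels up to \<open>card H\<close> are kept free for the reserved legs.\<close>

lemma pendant_assignment:
  fixes ctr :: "'l \<Rightarrow> 'c"
  assumes fin: "finite Pd" "finite H" and PH: "P \<subseteq> H"
    and rho: "\<And>c. c \<in> H \<Longrightarrow> \<rho> c \<in> Pd \<and> ctr (\<rho> c) = c"
    and yz: "\<And>c. c \<in> P \<Longrightarrow> y c \<in> Pd \<and> z c \<in> Pd \<and> ctr (y c) = c \<and> ctr (z c) = c \<and>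
               y c \<noteq> z c \<and> y c \<noteq> \<rho> c \<and> z c \<noteq> \<rho> c"
  shows "\<exists>v::'l \<Rightarrow> int. bij_betw v (Pd - \<rho> ` H) {int (card H) + 1..int (card Pd)} \<and>
           (\<forall>c\<in>P. v (y c) + v (z c) = 2 * int (card Pd) - 2 * int (card P) + 1)"
proof -
  have fP: "finite P" using fin PH finite_subset by blast
  let ?h = "int (card H)" and ?T = "int (card Pd)" and ?n = "int (card P)"
  obtain e where e: "bij_betw e P {0..<card P}" using fP ex_bij_betw_finite_nat by blast
  have irho: "inj_on \<rho> H" using rho by (metis inj_onI)
  have iy: "inj_on y P" using yz by (metis inj_onI)
  have iz: "inj_on z P" using yz by (metis inj_onI)
  have dyz: "y ` P \<inter> z ` P = {}" using yz by (auto simp: image_iff) (metis)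
  have dry: "\<rho> ` H \<inter> y ` P = {}" using yz rho by (auto simp: image_iff) (metis)
  have drz: "\<rho> ` H \<inter> z ` P = {}" using yz rho by (auto simp: image_iff) (metis)
  let ?A = "Pd - \<rho> ` H"
  let ?R = "?A - y ` P - z ` P"
  have sub: "\<rho> ` H \<union> (y ` P \<union> z ` P) \<subseteq> Pd" using rho yz by auto
  have "card (\<rho> ` H \<union> (y ` P \<union> z ` P)) = card H + (card P + card P)"
    using fin fP irho iy iz dyz dry drz
    by (subst card_Un_disjoint; (subst card_Un_disjoint)?) (auto simp: card_image)
  moreover have "?R = Pd - (\<rho> ` H \<union> (y ` P \<union> z ` P))" by blast
  ultimately have cR: "card ?R = card Pd - (card H + (card P + card P))"
    and le: "card H + (card P + card P) \<le> card Pd"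
    using card_mono[OF fin(1) sub] fin fP sub by (simp_all add: card_Diff_subset)
  have "card ?R = card {?h + 1..?T - 2 * ?n}" using cR le by simp
  then obtain b where b: "bij_betw b ?R {?h + 1..?T - 2 * ?n}"
    using fin by (metis finite_Diff finite_atLeastAtMost_int finite_same_card_bij)
  \<comment> \<open>The pairs grow outwards from the middle: as \<open>e\<close> runs from 0 to
    \<open>card P - 1\<close>, the first members fill the labels up to \<open>?T\<close> and the
    second ones those down to \<open>?T - 2 * ?n + 1\<close>.\<close>
  define v where "v l = (if l \<in> y ` P then ?T - ?n + 1 + int (e (ctr l))
      else if l \<in> z ` P then ?T - ?n - int (e (ctr l)) else b l)" for l
  have vy: "v (y c) = ?T - ?n + 1 + int (e c)" if "c \<in> P" for c
    using that yz by (auto simp: v_def)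
  have vz: "v (z c) = ?T - ?n - int (e c)" if "c \<in> P" for c
    using that yz dyz by (auto simp: v_def)
  have eb: "e c < card P" if "c \<in> P" for c using e that by (auto simp: bij_betw_def)
  have ei: "inj_on e P" using e by (auto simp: bij_betw_def)
  have bR: "?h + 1 \<le> b l \<and> b l \<le> ?T - 2 * ?n" if "l \<in> ?R" for l
    using b that by (auto simp: bij_betw_def)
  have rng: "v ` ?A \<subseteq> {?h + 1..?T}"
  proof
    fix t assume "t \<in> v ` ?A"
    then obtain l where l: "l \<in> ?A" "t = v l" by blast
    consider c where "c \<in> P" "l = y c" | c where "c \<in> P" "l = z c" | "l \<in> ?R" using l by blast
    then show "t \<in> {?h + 1..?T}"
    proof cases
      case 1 then show ?thesis using l vy eb[of c] le by auto
    next
      case 2 then show ?thesis using l vz eb[of c] le by auto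
    next
      case 3
      then have "v l = b l" by (auto simp: v_def)
      then show ?thesis using bR[OF 3] l by auto
    qed
  qed
  have inj: "inj_on v ?A"
  proof (rule inj_onI)
    fix l l' assume l: "l \<in> ?A" "l' \<in> ?A" "v l = v l'"
    have cs: "(\<exists>c\<in>P. l = y c) \<or> (\<exists>c\<in>P. l = z c) \<or> l \<in> ?R" if "l \<in> ?A" for l using that by blast
    have vR: "v l = b l" if "l \<in> ?R" for l using that by (auto simp: v_def)
    have bi: "inj_on b ?R" using b by (auto simp: bij_betw_def)
    show "l = l'"
      using cs[OF l(1)] cs[OF l(2)]
    proof (elim disjE bexE)
      fix c d assume "c \<in> P" "l = y c" "d \<in> P" "l' = y d"
      then show ?thesis using l(3) vy ei by (auto simp: inj_on_def)
    next
      fix c d assume "c \<in> P" "l = z c" "d \<in> P" "l' = z d"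
      then show ?thesis using l(3) vz ei by (auto simp: inj_on_def)
    next
      assume "l \<in> ?R" "l' \<in> ?R"
      then show ?thesis using l(3) vR bi by (metis inj_onD)
    next
      fix c d assume "c \<in> P" "l = y c" "d \<in> P" "l' = z d"
      then show ?thesis using l(3) vy[of c] vz[of d] by simp
    next
      fix c d assume "c \<in> P" "l = z c" "d \<in> P" "l' = y d"
      then show ?thesis using l(3) vy[of d] vz[of c] by simp
    next
      fix c assume "c \<in> P" "l = y c" "l' \<in> ?R"
      then show ?thesis using l(3) vy[of c] vR[of l'] bR[of l'] by simp
    next
      fix c assume "c \<in> P" "l = z c" "l' \<in> ?R"
      then show ?thesis using l(3) vz[of c] vR[of l'] bR[of l'] eb[of c] by simp
    next
      fix c assume "l \<in> ?R" "c \<in> P" "l' = y c"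
      then show ?thesis using l(3) vy[of c] vR[of l] bR[of l] by simp
    next
      fix c assume "l \<in> ?R" "c \<in> P" "l' = z c"
      then show ?thesis using l(3) vz[of c] vR[of l] bR[of l] eb[of c] by simp
    qed
  qed
  have "card ?A = card Pd - card H"
    using fin irho rho by (subst card_Diff_subset) (auto simp: card_image)
  then have "card (v ` ?A) = card {?h + 1..?T}" using inj by (simp add: card_image)
  then have "v ` ?A = {?h + 1..?T}" using rng by (simp add: card_subset_eq)
  then show ?thesis using inj vy vz by (intro exI[of _ v]) (auto simp: bij_betw_def)
qed

section \<open>The order of the even legs in the line\<close>

text \<open>With half the leg lengths as \<open>l\<close> and distinct ranks \<open>r\<close>, twice
  this value counts the edges of the line up to the end of leg \<open>p\<close>. The value itself is
  then the index, among the large labels, of the edge of \<open>p\<close> at its center.\<close>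

definition cumulative :: "'l set \<Rightarrow> ('l \<Rightarrow> nat) \<Rightarrow> ('l \<Rightarrow> nat) \<Rightarrow> 'l \<Rightarrow> nat" where
  "cumulative Ev l r p = (\<Sum>q | q \<in> Ev \<and> r q \<le> r p. l q)"

lemma cumulative_less:
  assumes "finite Ev" "q \<in> Ev" "r p < r q"
  shows "cumulative Ev l r p + l q \<le> cumulative Ev l r q"
proof -
  have "cumulative Ev l r p + l q = (\<Sum>x\<in>insert q {x \<in> Ev. r x \<le> r p}. l x)"
    using assms by (simp add: cumulative_def)
  also have "\<dots> \<le> cumulative Ev l r q"
    unfolding cumulative_def using assms by (intro sum_mono2) auto
  finally show ?thesis .
qed

lemma cumulative_ge: "finite Ev \<Longrightarrow> p \<in> Ev \<Longrightarrow> l p \<le> cumulative Ev l r p"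
  unfolding cumulative_def by (rule member_le_sum) auto

lemma cumulative_le: "finite Ev \<Longrightarrow> cumulative Ev l r p \<le> sum l Ev"
  unfolding cumulative_def by (rule sum_mono2) auto

text \<open>\<open>\<pi> c\<close> stands for the part of the sum at \<open>c\<close> that does not
  depend on the order. In the line the unreserved legs at \<open>N\<close> come first, then the legs
  \<open>a c\<close>, then the legs \<open>b c\<close>, and last the legs at other centers. Both
  rounds of reserved legs follow the sorted order of the remaining sums, and each adds at least 1 to
  the distance of two centers. A leg at a center outside \<open>N\<close> is preceded by
  \<open>2 * card N\<close> reserved legs; the leg itself gives the \<open>+ 1\<close>.\<close>

lemma even_leg_order:
  fixes ctr :: "'l \<Rightarrow> 'c" and \<pi> :: "'c \<Rightarrow> int"
  assumes fin: "finite Ev" "finite N" and l1: "\<And>p. p \<in> Ev \<Longrightarrow> 1 \<le> l p"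
    and ab: "\<And>c. c \<in> N \<Longrightarrow> a c \<in> Ev \<and> b c \<in> Ev \<and> a c \<noteq> b c \<and> ctr (a c) = c \<and> ctr (b c) = c"
  shows "\<exists>r::'l \<Rightarrow> nat. inj_on r Ev \<and>
      (\<forall>p\<in>Ev. ctr p \<notin> N \<longrightarrow> 2 * card N + 1 \<le> cumulative Ev l r p) \<and>
      (\<forall>c\<in>N. \<forall>d\<in>N. c \<noteq> d \<longrightarrow>
         2 \<le> \<bar>(\<pi> c + (\<Sum>p | p \<in> Ev \<and> ctr p = c. int (cumulative Ev l r p)))
            - (\<pi> d + (\<Sum>p | p \<in> Ev \<and> ctr p = d. int (cumulative Ev l r p)))\<bar>)"
proof -
  obtain r0 where r0: "bij_betw r0 Ev {0..<card Ev}" using fin ex_bij_betw_finite_nat by blast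
  have r0i: "inj_on r0 Ev" and r0l: "\<And>p. p \<in> Ev \<Longrightarrow> r0 p < card Ev"
    using r0 by (auto simp: bij_betw_def)
  define R where "R = {p \<in> Ev. ctr p \<in> N} - a ` N - b ` N"
  \<comment> \<open>The legs of \<open>R\<close> will come first in the line in the order of
    \<open>r0\<close>, so their contributions are final already. This is why the centers can be
    sorted by \<open>w\<close> before \<open>r\<close> is defined.\<close>
  define w where "w c = \<pi> c + (\<Sum>p | p \<in> R \<and> ctr p = c. int (cumulative R l r0 p))" for c
  obtain j :: "'c \<Rightarrow> nat" where j: "inj_on j N" "j ` N \<subseteq> {..<card N}"
    "\<forall>c\<in>N. \<forall>d\<in>N. j c < j d \<longrightarrow> w c \<le> w d" using sorted_enumeration[OF fin(2), of w] by blast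
  have ia: "inj_on a N" and ib: "inj_on b N" using ab by (metis inj_onI)+
  have dab: "a ` N \<inter> b ` N = {}" using ab by (auto simp: image_iff) metis
  let ?n = "card Ev" and ?m = "card N"
  \<comment> \<open>Since \<open>r0\<close> stays below \<open>?n\<close> and \<open>j\<close> below
    \<open>?m\<close>, the offsets separate the four blocks of the line.\<close>
  define r where "r p = (if ctr p \<notin> N then ?n + 2 * ?m + r0 p
     else if p \<in> a ` N then ?n + j (ctr p) else if p \<in> b ` N then ?n + ?m + j (ctr p) else r0 p)" for p
  have jl: "j c < ?m" if "c \<in> N" for c using j(2) that by auto
  have ra: "r (a c) = ?n + j c" if "c \<in> N" for c using that ab by (auto simp: r_def)
  have rb: "r (b c) = ?n + ?m + j c" if "c \<in> N" for c using that ab dab by (auto simp: r_def)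
  have rR: "r p = r0 p" "r p < ?n" if "p \<in> R" for p using that r0l by (auto simp: r_def R_def)
  have rS: "r p = ?n + 2 * ?m + r0 p" if "ctr p \<notin> N" for p using that by (auto simp: r_def)
  have cases4: "p \<in> R \<or> (\<exists>c\<in>N. p = a c) \<or> (\<exists>c\<in>N. p = b c) \<or> ctr p \<notin> N" if "p \<in> Ev" for p
    using that by (auto simp: R_def)
  have inj: "inj_on r Ev"
  proof (rule inj_onI)
    fix p q assume pq: "p \<in> Ev" "q \<in> Ev" "r p = r q"
    show "p = q"
      using cases4[OF pq(1)] cases4[OF pq(2)]
    proof (elim disjE bexE)
      assume "p \<in> R" "q \<in> R"
      then show ?thesis using rR pq r0i by (auto simp: inj_on_def)
    next
      fix c d assume "c \<in> N" "p = a c" "d \<in> N" "q = a d"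
      then show ?thesis using ra pq j(1) by (auto simp: inj_on_def)
    next
      fix c d assume "c \<in> N" "p = b c" "d \<in> N" "q = b d"
      then show ?thesis using rb pq j(1) by (auto simp: inj_on_def)
    next
      assume "ctr p \<notin> N" "ctr q \<notin> N"
      then show ?thesis using rS pq r0i by (auto simp: inj_on_def)
    qed (use pq ra rb rR rS jl in fastforce)+
  qed
  let ?B = "cumulative Ev l r"
  have S: "2 * ?m + 1 \<le> ?B p" if p: "p \<in> Ev" "ctr p \<notin> N" for p
  proof -
    have np: "p \<notin> a ` N \<union> b ` N" using p ab by auto
    have le: "r q \<le> r p" if "q \<in> a ` N \<union> b ` N" for q
      using that ra rb rS[OF p(2)] jl by fastforce
    have "2 * ?m + 1 = card (insert p (a ` N \<union> b ` N))"
      using np fin ia ib dab by (simp add: card_Un_disjoint card_image)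
    also have "\<dots> \<le> card {q \<in> Ev. r q \<le> r p}"
      using fin p ab le by (intro card_mono) auto
    also have "\<dots> \<le> ?B p"
      unfolding cumulative_def card_eq_sum using l1 by (intro sum_mono) auto
    finally show ?thesis .
  qed
  have BR: "?B p = cumulative R l r0 p" if p: "p \<in> R" for p
  proof -
    have "{q \<in> Ev. r q \<le> r p} = {q \<in> R. r0 q \<le> r0 p}"
    proof (intro set_eqI iffI)
      fix q assume q: "q \<in> {q \<in> Ev. r q \<le> r p}"
      then have "r q < ?n" using rR(2)[OF p] by auto
      then have "q \<in> R" using cases4[of q] q ra rb rS by fastforce
      then show "q \<in> {q \<in> R. r0 q \<le> r0 p}" using q rR p by auto
    qed (use rR p R_def in auto)
    then show ?thesis by (simp add: cumulative_def)
  qed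
  let ?t = "\<lambda>c. \<pi> c + (\<Sum>p | p \<in> Ev \<and> ctr p = c. int (?B p))"
  have tot: "?t c = w c + int (?B (a c)) + int (?B (b c))" if c: "c \<in> N" for c
  proof -
    have "{p. p \<in> Ev \<and> ctr p = c} = insert (a c) (insert (b c) {p. p \<in> R \<and> ctr p = c})"
      using c ab by (auto simp: R_def)
    moreover have "a c \<notin> insert (b c) {p. p \<in> R \<and> ctr p = c}" "b c \<notin> {p. p \<in> R \<and> ctr p = c}"
      using c ab by (auto simp: R_def)
    moreover have "finite {p. p \<in> R \<and> ctr p = c}" using fin by (auto simp: R_def)
    moreover have "(\<Sum>p | p \<in> R \<and> ctr p = c. int (?B p)) =
        (\<Sum>p | p \<in> R \<and> ctr p = c. int (cumulative R l r0 p))"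
      using BR by (intro sum.cong) auto
    ultimately show ?thesis by (simp add: w_def)
  qed
  have gap: "?t c + 2 \<le> ?t d" if "c \<in> N" "d \<in> N" "j c < j d" for c d
  proof -
    have "?B (a c) + l (a d) \<le> ?B (a d)" "?B (b c) + l (b d) \<le> ?B (b d)"
      using cumulative_less[OF fin(1)] that ab ra rb by auto
    moreover have "1 \<le> l (a d)" "1 \<le> l (b d)" using l1 ab that by auto
    moreover have "w c \<le> w d" using j(3) that by auto
    ultimately show ?thesis using tot that by auto
  qed
  have "2 \<le> \<bar>?t c - ?t d\<bar>" if "c \<in> N" "d \<in> N" "c \<noteq> d" for c d
  proof -
    have "j c \<noteq> j d" using j(1) that by (auto simp: inj_on_def)
    then show ?thesis using gap[of c d] gap[of d c] that by linarith
  qed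
  then show ?thesis using inj S by blast
qed

section \<open>Labeling the legs\<close>

lemma sum_ge_subset:
  fixes f :: "'b \<Rightarrow> int"
  assumes "finite X" "Y \<subseteq> X" "\<And>p. p \<in> X \<Longrightarrow> 0 \<le> f p"
  shows "sum f Y \<le> sum f X"
  using assms by (intro sum_mono2) auto

lemma two_elements:
  assumes "2 \<le> card X"
  shows "\<exists>a b. a \<in> X \<and> b \<in> X \<and> a \<noteq> b"
proof -
  obtain Y where "Y \<subseteq> X" "card Y = 2" using assms by (metis obtain_subset_with_card_n)
  then show ?thesis by (auto simp: card_2_iff)
qed

lemma three_elements:
  assumes "3 \<le> card X"
  shows "\<exists>a b c. a \<in> X \<and> b \<in> X \<and> c \<in> X \<and> a \<noteq> b \<and> a \<noteq> c \<and> b \<noteq> c"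
proof -
  obtain Y where "Y \<subseteq> X" "card Y = 3" using assms by (metis obtain_subset_with_card_n)
  then show ?thesis by (auto simp: card_3_iff)
qed

section \<open>Labels on a family of legs, detached from the graph\<close>

context
  fixes A :: "'l set" and len :: "'l \<Rightarrow> nat" and ctr :: "'l \<Rightarrow> 'c" and k :: int
  assumes fin: "finite A" and len: "\<And>p. p \<in> A \<Longrightarrow> len p = 1 \<or> even (len p) \<and> 0 < len p"
    and three: "\<And>p. p \<in> A \<Longrightarrow> 3 \<le> card {q \<in> A. ctr q = ctr p}" and k0: "0 \<le> k"
begin

text \<open>
  \<open>r\<close> ranks the even legs in the line, and the labels of the edges at the center are written relative
  to \<open>base\<close>: \<open>base + v p\<close> on a leg of length 1 and \<open>base + npend + reach r p\<close> on an even leg.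
\<close>

definition "pendants = {p \<in> A. len p = 1}"
definition "long_legs = {p \<in> A. len p \<noteq> 1}"
definition "half p = len p div 2"
definition "half_sum = int (sum half long_legs)"
definition "npend = int (card pendants)"
definition "base = k + half_sum"
definition "reach r p = int (cumulative long_legs half r p)"
definition "first_label v r p = (if len p = 1 then base + v p else base + npend + reach r p)"
definition "center_sum v r c = (\<Sum>p | p \<in> A \<and> ctr p = c. first_label v r p)"

lemma finite_pendants: "finite pendants" and finite_long_legs: "finite long_legs"
  using fin by (auto simp: pendants_def long_legs_def)

lemma half_pos: "p \<in> long_legs \<Longrightarrow> 1 \<le> half p"
  and long_len: "p \<in> long_legs \<Longrightarrow> len p = 2 * half p"
  using len[of p] by (auto simp: long_legs_def half_def elim!: evenE)

lemma reach_ge_half: "p \<in> long_legs \<Longrightarrow> int (half p) \<le> reach r p"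
  using cumulative_ge[OF finite_long_legs] by (simp add: reach_def)

lemma reach_pos: "p \<in> long_legs \<Longrightarrow> 1 \<le> reach r p"
  using reach_ge_half[of p r] half_pos[of p] by linarith

lemma base_nonneg: "0 \<le> half_sum" "half_sum \<le> base" "k \<le> base" "0 \<le> npend"
  using k0 by (auto simp: base_def half_sum_def npend_def simp del: of_nat_sum)

lemma center_sum_split:
  "center_sum v r c = (\<Sum>p | p \<in> pendants \<and> ctr p = c. base + v p)
     + (\<Sum>p | p \<in> long_legs \<and> ctr p = c. base + npend + reach r p)"
proof -
  have "{p. p \<in> A \<and> ctr p = c} = {p. p \<in> pendants \<and> ctr p = c} \<union> {p. p \<in> long_legs \<and> ctr p = c}"
    by (auto simp: pendants_def long_legs_def)
  moreover have "{p. p \<in> pendants \<and> ctr p = c} \<inter> {p. p \<in> long_legs \<and> ctr p = c} = {}"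
    by (auto simp: pendants_def long_legs_def)
  moreover have "(\<Sum>p | p \<in> pendants \<and> ctr p = c. first_label v r p) =
      (\<Sum>p | p \<in> pendants \<and> ctr p = c. base + v p)"
    by (rule sum.cong) (auto simp: first_label_def pendants_def)
  moreover have "(\<Sum>p | p \<in> long_legs \<and> ctr p = c. first_label v r p) =
      (\<Sum>p | p \<in> long_legs \<and> ctr p = c. base + npend + reach r p)"
    by (rule sum.cong) (auto simp: first_label_def long_legs_def)
  ultimately show ?thesis
    using finite_pendants finite_long_legs by (simp add: center_sum_def sum.union_disjoint)
qed

text \<open>\<open>half_sum\<close> and \<open>npend\<close> are the numbers \<open>L\<close> and
  \<open>T\<close> of the outline, so the large labels start right after
  \<open>base + npend\<close>. In the proof \<open>h\<close> is the number of centers with at most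
  one even leg. Legs of length 1 take all relative labels above \<open>h\<close>, so small labels
  are at most \<open>base + h\<close>. Together with \<open>half_sum \<le> base\<close> this bounds
  a small plus a large label by \<open>3 * base + npend + h\<close>, the value that center sums have
  to exceed.\<close>

lemma center_labels:
  "\<exists>(v :: 'l \<Rightarrow> int) r h. inj_on v pendants \<and> v ` pendants \<subseteq> {1 - half_sum..npend} \<and>
      0 \<le> h \<and> h \<le> npend \<and> {h + 1..npend} \<subseteq> v ` pendants \<and> inj_on r long_legs \<and>
      inj_on (center_sum v r) (ctr ` A) \<and>
      (\<forall>c\<in>ctr ` A. 3 * base + npend + h < center_sum v r c)"
proof -
  define pd where "pd c = {p. p \<in> pendants \<and> ctr p = c}" for c
  define ev where "ev c = {p. p \<in> long_legs \<and> ctr p = c}" for c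
  define N where "N = {c \<in> ctr ` A. 2 \<le> card (ev c)}"
  define H where "H = ctr ` A - N"
  \<comment> \<open>\<open>P\<close>: the centers of stars; \<open>D\<close>: the centers in \<open>H\<close> that may have to pass over a label.\<close>
  define P where "P = {c \<in> H. ev c = {}}"
  define D where "D = {c \<in> H. c \<in> P \<longrightarrow> 4 \<le> card (pd c)}"
  define h where "h = int (card H)"
  have fpd: "finite (pd c)" and fev: "finite (ev c)" for c
    using finite_pendants finite_long_legs by (auto simp: pd_def ev_def)
  have fins: "finite N" "finite H" "finite P" "finite D"
    using fin by (auto simp: N_def H_def P_def D_def)
  have PH: "P \<subseteq> H" "D \<subseteq> H" by (auto simp: P_def D_def)
  have c3: "3 \<le> card (pd c) + card (ev c)" if "c \<in> ctr ` A" for c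
  proof -
    have "{q \<in> A. ctr q = c} = pd c \<union> ev c" "pd c \<inter> ev c = {}"
      by (auto simp: pd_def ev_def pendants_def long_legs_def)
    moreover have "3 \<le> card {q \<in> A. ctr q = c}" using that three by auto
    ultimately show ?thesis using fpd fev by (metis card_Un_disjoint)
  qed
  have cH: "card (ev c) \<le> 1" if "c \<in> H" for c using that by (auto simp: H_def N_def)
  have cP: "3 \<le> card (pd c)" if "c \<in> P" for c using that c3[of c] by (auto simp: P_def H_def)
  have cS: "2 \<le> card (pd c)" if "c \<in> H" for c using that c3[of c] cH[of c] by (auto simp: H_def)
  have "\<exists>a b. a \<in> ev c \<and> b \<in> ev c \<and> a \<noteq> b" if "c \<in> N" for c
    using that two_elements by (auto simp: N_def)
  then obtain a b where ab: "\<And>c. c \<in> N \<Longrightarrow> a c \<in> ev c \<and> b c \<in> ev c \<and> a c \<noteq> b c" by metis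
  have "\<exists>x y z. x \<in> pd c \<and> y \<in> pd c \<and> x \<noteq> y \<and> (c \<in> P \<longrightarrow> z \<in> pd c \<and> z \<noteq> x \<and> z \<noteq> y)" if "c \<in> H" for c
  proof (cases "c \<in> P")
    case True
    then show ?thesis using three_elements[OF cP] by metis
  next
    case False
    then show ?thesis using two_elements[OF cS[OF that]] by metis
  qed
  \<comment> \<open>\<open>\<rho> c\<close> is reserved for the greedy choice. The further legs
    \<open>y c\<close>, and at a star also \<open>z c\<close>, are there to keep the sum at
    \<open>c\<close> large.\<close>
  then obtain \<rho> y z where ryz: "\<And>c. c \<in> H \<Longrightarrow> \<rho> c \<in> pd c \<and> y c \<in> pd c \<and> \<rho> c \<noteq> y c \<and>
      (c \<in> P \<longrightarrow> z c \<in> pd c \<and> z c \<noteq> \<rho> c \<and> z c \<noteq> y c)" by metis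
  have "\<exists>v::'l \<Rightarrow> int. bij_betw v (pendants - \<rho> ` H) {int (card H) + 1..int (card pendants)} \<and>
           (\<forall>c\<in>P. v (y c) + v (z c) = 2 * int (card pendants) - 2 * int (card P) + 1)"
  proof (rule pendant_assignment[OF finite_pendants fins(2) PH(1)])
    show "\<rho> c \<in> pendants \<and> ctr (\<rho> c) = c" if "c \<in> H" for c
      using ryz[OF that] by (simp add: pd_def)
    show "y c \<in> pendants \<and> z c \<in> pendants \<and> ctr (y c) = c \<and> ctr (z c) = c \<and>
        y c \<noteq> z c \<and> y c \<noteq> \<rho> c \<and> z c \<noteq> \<rho> c" if "c \<in> P" for c
      using ryz[of c] that PH by (auto simp: pd_def)
  qed
  then obtain v0 :: "'l \<Rightarrow> int" where v0: "bij_betw v0 (pendants - \<rho> ` H) {h + 1..npend}"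
    and v0yz: "\<And>c. c \<in> P \<Longrightarrow> v0 (y c) + v0 (z c) = 2 * npend - 2 * int (card P) + 1"
    unfolding h_def npend_def by blast
  have v0r: "h + 1 \<le> v0 p \<and> v0 p \<le> npend" if "p \<in> pendants" "p \<notin> \<rho> ` H" for p
    using v0 that by (auto simp: bij_betw_def)
  have rho: "\<rho> c \<in> pendants" "ctr (\<rho> c) = c" if "c \<in> H" for c using ryz[OF that] by (auto simp: pd_def)
  have rho_iff: "p \<in> \<rho> ` H \<longleftrightarrow> ctr p \<in> H \<and> p = \<rho> (ctr p)" for p using rho by (auto simp: image_iff)
  have h0: "0 \<le> h" by (simp add: h_def)
  \<comment> \<open>A center in \<open>H\<close> has at least two legs of length 1, at least three
    if it is the center of a star and at least four if it also lies in \<open>D\<close>. This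
    matches its weight on the left in every case.\<close>
  have count: "h + 2 * int (card P) + int (card D) \<le> npend"
  proof -
    have "(\<Sum>c\<in>H. if c \<in> X then m else 0) = m * card X" if "X \<subseteq> H" for X m
      using that fins by (simp add: sum.If_cases Int_absorb1)
    then have "card H + 2 * card P + card D = (\<Sum>c\<in>H. 1) + (\<Sum>c\<in>H. if c \<in> P then 2 else 0) + (\<Sum>c\<in>H. if c \<in> D then 1 else 0)"
      using PH by simp
    also have "\<dots> = (\<Sum>c\<in>H. 1 + (if c \<in> P then 2 else 0) + (if c \<in> D then 1 else 0))"
      by (simp only: sum.distrib)
    also have "\<dots> \<le> (\<Sum>c\<in>H. card (pd c))"
    proof (rule sum_mono)
      fix c assume "c \<in> H"
      then show "1 + (if c \<in> P then 2 else 0) + (if c \<in> D then 1 else 0) \<le> card (pd c)"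
        using cP[of c] cS[of c] by (auto simp: D_def)
    qed
    also have "\<dots> = card (\<Union>c\<in>H. pd c)"
      using fins fpd by (subst card_UN_disjoint) (auto simp: pd_def)
    also have "\<dots> \<le> card pendants" using finite_pendants by (intro card_mono) (auto simp: pd_def)
    finally show ?thesis by (simp add: h_def npend_def)
  qed
  \<comment> \<open>A center in \<open>N\<close> has no reserved leg of length 1, so
    \<open>v0\<close> is final there and \<open>\<pi> c\<close> is known before the even legs are
    ordered.\<close>
  define \<pi> where "\<pi> c = (\<Sum>p\<in>pd c. base + v0 p) + int (card (ev c)) * (base + npend)" for c
  have "\<exists>r::'l \<Rightarrow> nat. inj_on r long_legs \<and>
      (\<forall>p\<in>long_legs. ctr p \<notin> N \<longrightarrow> 2 * card N + 1 \<le> cumulative long_legs half r p) \<and>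
      (\<forall>c\<in>N. \<forall>d\<in>N. c \<noteq> d \<longrightarrow>
         2 \<le> \<bar>(\<pi> c + (\<Sum>p | p \<in> long_legs \<and> ctr p = c. int (cumulative long_legs half r p)))
            - (\<pi> d + (\<Sum>p | p \<in> long_legs \<and> ctr p = d. int (cumulative long_legs half r p)))\<bar>)"
    using ab by (intro even_leg_order[OF finite_long_legs fins(1) half_pos, where a = a and b = b])
      (auto simp: ev_def)
  then obtain r :: "'l \<Rightarrow> nat" where r: "inj_on r long_legs"
    and rS: "\<And>p. p \<in> long_legs \<Longrightarrow> ctr p \<notin> N \<Longrightarrow> 2 * int (card N) + 1 \<le> reach r p"
    and gap: "\<And>c d. c \<in> N \<Longrightarrow> d \<in> N \<Longrightarrow> c \<noteq> d \<Longrightarrow>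
       2 \<le> \<bar>(\<pi> c + (\<Sum>p\<in>ev c. reach r p)) - (\<pi> d + (\<Sum>p\<in>ev d. reach r p))\<bar>"
    unfolding reach_def ev_def by fastforce
  define tot where "tot c = \<pi> c + (\<Sum>p\<in>ev c. reach r p)" for c
  have tot_eq: "tot c = (\<Sum>p\<in>pd c. base + v0 p) + (\<Sum>p\<in>ev c. base + npend + reach r p)" for c
    by (simp add: tot_def \<pi>_def sum.distrib)
  define F where "F = tot ` N"
  \<comment> \<open>The leading \<open>base\<close> belongs to the reserved leg; its relative label
    \<open>x c\<close> is added once the greedy choice is made.\<close>
  define w where "w c = base + (\<Sum>p\<in>pd c - {\<rho> c}. base + v0 p) + (\<Sum>p\<in>ev c. base + npend + reach r p)" for c
  have b0: "0 \<le> base" using base_nonneg by linarith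
  have evpos: "base + npend + 1 \<le> base + npend + reach r p" if "p \<in> ev c" for p c
    using reach_pos that by (simp add: ev_def)
  have pdpos: "base + h + 1 \<le> base + v0 p" if "p \<in> pd c" "p \<notin> \<rho> ` H" for p c
    using v0r that by (simp add: pd_def)
  have sev: "(\<Sum>p\<in>Y. base + npend + reach r p) \<le> (\<Sum>p\<in>ev c. base + npend + reach r p)" if "Y \<subseteq> ev c" for Y c
    by (rule sum_ge_subset[OF fev that]) (use evpos b0 base_nonneg in force)
  \<comment> \<open>Either there are three even legs, each with a large label at the center, or two
    of them and a leg of length 1. The latter is not reserved, so its relative label exceeds
    \<open>h\<close>.\<close>
  have totN: "3 * base + 2 * npend + h + 3 \<le> tot c" if c: "c \<in> N" for c
  proof -
    have nr: "p \<notin> \<rho> ` H" if "p \<in> pd c" for p using that c rho_iff by (auto simp: pd_def H_def)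
    have spd: "(\<Sum>p\<in>Y. base + v0 p) \<le> (\<Sum>p\<in>pd c. base + v0 p)" if "Y \<subseteq> pd c" for Y
      by (rule sum_ge_subset[OF fpd that]) (use pdpos nr b0 h0 in force)
    have abc: "a c \<in> ev c" "b c \<in> ev c" "a c \<noteq> b c" using ab c by auto
    have hn: "h \<le> npend" using count by linarith
    show ?thesis
    proof (cases "3 \<le> card (ev c)")
      case True
      then obtain p q s where p: "p \<in> ev c" "q \<in> ev c" "s \<in> ev c" "p \<noteq> q" "p \<noteq> s" "q \<noteq> s"
        using three_elements by metis
      have "3 * (base + npend + 1) \<le> (\<Sum>x\<in>{p, q, s}. base + npend + reach r x)"
        using p evpos[OF p(1)] evpos[OF p(2)] evpos[OF p(3)] by simp
      also have "\<dots> \<le> (\<Sum>p\<in>ev c. base + npend + reach r p)" using p by (intro sev) auto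
      finally show ?thesis using spd[of "{}"] hn by (simp add: tot_eq)
    next
      case False
      then have "pd c \<noteq> {}" using c3[of c] c by (auto simp: N_def)
      then obtain q where q: "q \<in> pd c" by blast
      have "base + h + 1 \<le> (\<Sum>p\<in>pd c. base + v0 p)"
        using spd[of "{q}"] q pdpos[OF q nr[OF q]] by simp
      moreover have "2 * (base + npend + 1) \<le> (\<Sum>x\<in>{a c, b c}. base + npend + reach r x)"
        using abc evpos[OF abc(1)] evpos[OF abc(2)] by simp
      moreover have "\<dots> \<le> (\<Sum>p\<in>ev c. base + npend + reach r p)" using abc by (intro sev) auto
      ultimately show ?thesis by (simp add: tot_eq)
    qed
  qed
  have nrho: "p \<notin> \<rho> ` H" if "p \<in> pd c - {\<rho> c}" for p c using that rho_iff by (auto simp: pd_def)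
  have spd: "(\<Sum>p\<in>Y. base + v0 p) \<le> (\<Sum>p\<in>pd c - {\<rho> c}. base + v0 p)" if "Y \<subseteq> pd c - {\<rho> c}" for Y c
    by (rule sum_ge_subset) (use that fpd pdpos nrho b0 h0 in force)+
  have wP: "3 * base + 2 * npend - 2 * int (card P) + 1 \<le> w c" if c: "c \<in> P" for c
  proof -
    have yz: "y c \<in> pd c - {\<rho> c}" "z c \<in> pd c - {\<rho> c}" "y c \<noteq> z c" using ryz[of c] c PH by auto
    have "2 * base + 2 * npend - 2 * int (card P) + 1 = (\<Sum>p\<in>{y c, z c}. base + v0 p)"
      using yz v0yz[OF c] by simp
    also have "\<dots> \<le> (\<Sum>p\<in>pd c - {\<rho> c}. base + v0 p)" using yz by (intro spd) auto
    finally show ?thesis using c by (simp add: w_def P_def)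
  qed
  \<comment> \<open>The even leg at \<open>c\<close> follows all \<open>2 * card N\<close> reserved
    even legs in the line. This surplus makes up for the decrease of \<open>x c\<close> caused by at
    most \<open>card N\<close> forbidden sums.\<close>
  have wS: "3 * base + npend + 2 * int (card N) + h + 2 \<le> w c" if c: "c \<in> H" "c \<notin> P" for c
  proof -
    obtain q where q: "q \<in> ev c" using c by (auto simp: P_def)
    have "2 * int (card N) + 1 \<le> reach r q" using q c by (intro rS) (auto simp: ev_def H_def)
    then have "base + npend + 2 * int (card N) + 1 \<le> (\<Sum>p\<in>ev c. base + npend + reach r p)"
      using sev[of "{q}" c] q by simp
    moreover have "y c \<in> pd c - {\<rho> c}" using ryz[OF c(1)] by auto
    then have "base + h + 1 \<le> (\<Sum>p\<in>pd c - {\<rho> c}. base + v0 p)"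
      using spd[of "{y c}" c] pdpos[of "y c" c] nrho[of "y c" c] by auto
    ultimately show ?thesis by (simp add: w_def)
  qed
  have "\<exists>x. inj_on x H \<and> inj_on (\<lambda>c. w c + x c) H \<and>
           (\<forall>c\<in>H. w c + x c \<notin> F \<and> x c \<le> h \<and>
              h + 1 - int (card H) - int (card F) \<le> x c \<and>
              h + 1 - int (card H) - int (card D) \<le> x c)"
  proof (rule greedy_avoiding_sums[OF fins(2) _ PH(2)])
    show "finite F" using fins by (simp add: F_def)
    show "t - 1 \<notin> F" if "t \<in> F" for t
    proof
      assume "t - 1 \<in> F"
      then obtain c d where cd: "c \<in> N" "d \<in> N" "t = tot c" "t - 1 = tot d" using \<open>t \<in> F\<close> by (auto simp: F_def)
      then have "c \<noteq> d" by auto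
      then show False using gap[of c d] cd by (simp add: tot_def)
    qed
    show "w c + t \<notin> F" if c: "c \<in> H - D" and t: "t \<le> h" for c t
    proof -
      \<comment> \<open>A center of \<open>H\<close> outside \<open>D\<close> belongs to a star with
        exactly three edges. The total of its pair fixes \<open>w c\<close>, and adding at most
        \<open>h\<close> leaves it below every member of \<open>F\<close>.\<close>
      have cP': "c \<in> P" "\<not> 4 \<le> card (pd c)" using c by (auto simp: D_def)
      then have "card (pd c) = 3" using cP[of c] by linarith
      moreover have yz: "{\<rho> c, y c, z c} \<subseteq> pd c" "\<rho> c \<noteq> y c" "\<rho> c \<noteq> z c" "y c \<noteq> z c"
        using ryz[of c] c cP' by auto
      then have "card {\<rho> c, y c, z c} = 3" by simp
      ultimately have "{\<rho> c, y c, z c} = pd c" using fpd yz(1) by (metis card_subset_eq)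
      then have "pd c - {\<rho> c} = {y c, z c}" using yz by auto
      then have "w c = 3 * base + 2 * npend - 2 * int (card P) + 1"
        using yz(4) v0yz[OF cP'(1)] cP'(1) by (simp add: w_def P_def)
      then show ?thesis using totN t by (force simp: F_def)
    qed
  qed
  then obtain x where x: "inj_on x H" "inj_on (\<lambda>c. w c + x c) H"
    and xF: "\<And>c. c \<in> H \<Longrightarrow> w c + x c \<notin> F" and xh: "\<And>c. c \<in> H \<Longrightarrow> x c \<le> h"
    and xl: "\<And>c. c \<in> H \<Longrightarrow> 1 - int (card F) \<le> x c" "\<And>c. c \<in> H \<Longrightarrow> 1 - int (card D) \<le> x c"
    unfolding h_def by (auto simp: algebra_simps)
  have FN: "card F \<le> card N" using fins by (simp add: F_def card_image_le)
  \<comment> \<open>The legs \<open>a c\<close> are distinct and each contributes at least 1 to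
    \<open>half_sum\<close>. Hence the greedy labels stay at or above \<open>1 - half_sum\<close>,
    which corresponds to the smallest label \<open>k + 1\<close>.\<close>
  have NL: "int (card N) \<le> half_sum"
  proof -
    have "inj_on a N" using ab by (auto simp: inj_on_def ev_def) metis
    then have "card N = card (a ` N)" by (simp add: card_image)
    also have "\<dots> \<le> card long_legs" using ab finite_long_legs by (intro card_mono) (auto simp: ev_def)
    also have "\<dots> \<le> sum half long_legs" unfolding card_eq_sum using half_pos by (intro sum_mono) auto
    finally show ?thesis unfolding half_sum_def by (rule of_nat_mono)
  qed
  define v where "v p = (if p \<in> \<rho> ` H then x (ctr p) else v0 p)" for p
  have vinj: "inj_on v pendants"
  proof (rule inj_onI)
    fix p q assume pq: "p \<in> pendants" "q \<in> pendants" "v p = v q"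
    have v0i: "inj_on v0 (pendants - \<rho> ` H)" using v0 by (auto simp: bij_betw_def)
    show "p = q"
    proof (cases "p \<in> \<rho> ` H"; cases "q \<in> \<rho> ` H")
      assume "p \<in> \<rho> ` H" "q \<in> \<rho> ` H"
      then show ?thesis using pq(3) rho_iff[of p] rho_iff[of q] x(1) unfolding v_def inj_on_def by metis
    next
      assume "p \<in> \<rho> ` H" "q \<notin> \<rho> ` H"
      then show ?thesis using pq rho_iff[of p] xh[of "ctr p"] v0r[of q] by (simp add: v_def)
    next
      assume "p \<notin> \<rho> ` H" "q \<in> \<rho> ` H"
      then show ?thesis using pq rho_iff[of q] xh[of "ctr q"] v0r[of p] by (simp add: v_def)
    next
      assume "p \<notin> \<rho> ` H" "q \<notin> \<rho> ` H"
      then show ?thesis using pq v0i by (auto simp: v_def inj_on_def)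
    qed
  qed
  have vrng: "v p \<in> {1 - half_sum..npend}" if "p \<in> pendants" for p
  proof (cases "p \<in> \<rho> ` H")
    case True
    then have "ctr p \<in> H" using rho_iff by blast
    then have "x (ctr p) \<le> h" "1 - int (card F) \<le> x (ctr p)" using xh xl by auto
    then show ?thesis using True FN NL count by (simp add: v_def)
  next
    case False
    then show ?thesis using v0r[OF that False] h0 base_nonneg(1) by (simp add: v_def)
  qed
  have vtop: "{h + 1..npend} \<subseteq> v ` pendants"
  proof
    fix t assume "t \<in> {h + 1..npend}"
    then obtain p where "p \<in> pendants - \<rho> ` H" "t = v0 p" using v0 unfolding bij_betw_def by blast
    then show "t \<in> v ` pendants" by (auto simp: v_def)
  qed
  have csN: "center_sum v r c = tot c" if c: "c \<in> N" for c
  proof -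
    have "(\<Sum>p\<in>pd c. base + v p) = (\<Sum>p\<in>pd c. base + v0 p)"
      using c rho_iff by (intro sum.cong) (auto simp: v_def pd_def H_def)
    then show ?thesis by (simp add: center_sum_split tot_eq pd_def ev_def)
  qed
  have csH: "center_sum v r c = w c + x c" if c: "c \<in> H" for c
  proof -
    have "(\<Sum>p\<in>pd c. base + v p) = base + v (\<rho> c) + (\<Sum>p\<in>pd c - {\<rho> c}. base + v p)"
      using ryz[OF c] fpd by (intro sum.remove) auto
    also have "v (\<rho> c) = x c" using c rho by (simp add: v_def)
    also have "(\<Sum>p\<in>pd c - {\<rho> c}. base + v p) = (\<Sum>p\<in>pd c - {\<rho> c}. base + v0 p)"
      using nrho by (intro sum.cong) (auto simp: v_def)
    finally show ?thesis by (simp add: center_sum_split w_def pd_def ev_def)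
  qed
  have NH: "c \<in> N \<or> c \<in> H" if "c \<in> ctr ` A" for c using that by (simp add: H_def)
  have csinj: "inj_on (center_sum v r) (ctr ` A)"
  proof (rule inj_onI)
    fix c d assume cd: "c \<in> ctr ` A" "d \<in> ctr ` A" "center_sum v r c = center_sum v r d"
    consider "c \<in> N" "d \<in> N" | "c \<in> N" "d \<in> H" | "c \<in> H" "d \<in> N" | "c \<in> H" "d \<in> H"
      using NH cd by blast
    then show "c = d"
    proof cases
      case 1
      then show ?thesis using gap[of c d] cd(3) csN by (force simp: tot_def)
    next
      case 2
      moreover have "tot c \<in> F" using 2 by (simp add: F_def)
      ultimately show ?thesis using cd(3) csN[of c] csH[of d] xF[of d] by simp
    next
      case 3
      moreover have "tot d \<in> F" using 3 by (simp add: F_def)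
      ultimately show ?thesis using cd(3) csN[of d] csH[of c] xF[of c] by simp
    next
      case 4
      then show ?thesis using cd(3) csH x(2) by (auto simp: inj_on_def)
    qed
  qed
  \<comment> \<open>Stars combine the bound on \<open>x\<close> through \<open>card D\<close> with
    \<open>count\<close>; the other centers of \<open>H\<close> combine the bound through
    \<open>card F\<close> with \<open>FN\<close>.\<close>
  have csbig: "3 * base + npend + h < center_sum v r c" if c: "c \<in> ctr ` A" for c
  proof -
    consider "c \<in> N" | "c \<in> P" | "c \<in> H" "c \<notin> P" using NH[OF c] by blast
    then show ?thesis
    proof cases
      case 1
      then show ?thesis using totN csN base_nonneg by force
    next
      case 2
      then have "c \<in> H" using PH by auto
      then show ?thesis using wP[OF 2] csH xl(2)[of c] count by simp
    next
      case 3
      then show ?thesis using wS[OF 3] csH xl(1)[of c] FN by simp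
    qed
  qed
  have "h \<le> npend" using count by linarith
  then show ?thesis using vinj vrng vtop r csinj csbig h0 by (intro exI[of _ v] exI[of _ r] exI[of _ h]) auto
qed

text \<open>The pair \<open>(p, i)\<close> stands for the edge number \<open>i\<close> of leg
  \<open>p\<close>, counted from 0 at the center. The thresholds separate leaves, vertices of degree
  2 and centers. Centers are compared with both thresholds, because without vertices of degree 2 the
  other clauses do not relate \<open>m1\<close> to \<open>m2\<close>.\<close>

lemma leg_labeling:
  "\<exists>(g :: 'l \<Rightarrow> nat \<Rightarrow> int) m1 m2.
     inj_on (\<lambda>(p, i). g p i) (SIGMA p:A. {..<len p}) \<and>
     (\<forall>p\<in>A. \<forall>i<len p. k + 1 \<le> g p i \<and> g p i \<le> k + int (sum len A)) \<and>
     (\<forall>p\<in>A. g p (len p - 1) \<le> m1) \<and>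
     (\<forall>p\<in>A. \<forall>i. Suc i < len p \<longrightarrow> m1 < g p i + g p (Suc i) \<and> g p i + g p (Suc i) \<le> m2) \<and>
     inj_on (\<lambda>(p, i). g p i + g p (Suc i)) {(p, i). p \<in> A \<and> Suc i < len p} \<and>
     (\<forall>c\<in>ctr ` A. m1 < (\<Sum>p | p \<in> A \<and> ctr p = c. g p 0) \<and> m2 < (\<Sum>p | p \<in> A \<and> ctr p = c. g p 0)) \<and>
     inj_on (\<lambda>c. \<Sum>p | p \<in> A \<and> ctr p = c. g p 0) (ctr ` A)"
proof -
  obtain v :: "'l \<Rightarrow> int" and r :: "'l \<Rightarrow> nat" and h
    where v: "inj_on v pendants" "v ` pendants \<subseteq> {1 - half_sum..npend}" "{h + 1..npend} \<subseteq> v ` pendants"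
      and h: "0 \<le> h" "h \<le> npend" and r: "inj_on r long_legs"
      and cs: "inj_on (center_sum v r) (ctr ` A)"
        "\<forall>c\<in>ctr ` A. 3 * base + npend + h < center_sum v r c"
    using center_labels by (elim exE conjE) (rule that)
  define L where "L = sum half long_legs"
  have hs: "half_sum = int L" by (simp add: half_sum_def L_def)
  \<comment> \<open>These are the small labels: everything up to \<open>base + npend\<close> that
    the legs of length 1 leave over, including the labels passed over in the greedy choice.\<close>
  define S where "S = {k + 1..base + npend} - (\<lambda>p. base + v p) ` pendants"
  define s where "s j = sorted_list_of_set S ! j" for j
  have cS: "card S = L"
  proof -
    have "(\<lambda>p. base + v p) ` pendants \<subseteq> {k + 1..base + npend}" using v(2) by (force simp: base_def)
    moreover have "card ((\<lambda>p. base + v p) ` pendants) = card pendants"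
      using v(1) by (intro card_image) (auto simp: inj_on_def)
    moreover have "card {k + 1..base + npend} = L + card pendants"
      by (simp add: base_def hs npend_def)
    ultimately show ?thesis using finite_pendants by (simp add: S_def card_Diff_subset)
  qed
  have fS: "finite S" by (simp add: S_def)
  have sS: "s j \<in> S" if "j < L" for j
    using that cS fS by (metis nth_mem s_def set_sorted_list_of_set length_sorted_list_of_set)
  have smono: "s i < s j" if "i < j" "j < L" for i j
    using that cS fS sorted_wrt_nth_less[OF strict_sorted_list_of_set, of i j S]
    by (simp add: s_def)
  have sle: "s i \<le> s j" if "i \<le> j" "j < L" for i j
    using that smono[of i j] by (cases "i = j") auto
  \<comment> \<open>Every label from \<open>base + h + 1\<close> to \<open>base + npend\<close> is
    taken by a leg of length 1.\<close>
  have sb: "k + 1 \<le> s j \<and> s j \<le> base + h" if "j < L" for j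
  proof -
    have sj: "s j \<in> S" using sS that .
    have top: "t \<in> (\<lambda>p. base + v p) ` pendants" if "base + h < t" "t \<le> base + npend" for t
    proof -
      have "t - base \<in> v ` pendants" using v(3) that by auto
      then show ?thesis by force
    qed
    have "s j \<notin> (\<lambda>p. base + v p) ` pendants" "k + 1 \<le> s j" "s j \<le> base + npend"
      using sj by (simp_all add: S_def)
    then show ?thesis using top[of "s j"] by linarith
  qed
  \<comment> \<open>The label at position \<open>n\<close> of the line, counted from 0: small at
    even and large at odd positions, both increasing.\<close>
  define \<tau> where "\<tau> n = (if even n then s (n div 2) else base + npend + 1 + int (n div 2))" for n
  \<comment> \<open>The positions of the edges of leg \<open>p\<close> in the line end with that of its edge at the center,
    which is \<open>2 * reach r p - 1\<close>.\<close>
  define ix where "ix p i = 2 * cumulative long_legs half r p - 1 - i" for p i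
  define g where "g p i = (if len p = 1 then base + v p else \<tau> (ix p i))" for p i
  let ?B = "cumulative long_legs half r"
  have Bge: "half p \<le> ?B p" if "p \<in> long_legs" for p using cumulative_ge[OF finite_long_legs that] .
  have Ble: "?B p \<le> L" for p using cumulative_le[OF finite_long_legs] by (simp add: L_def)
  have ixb: "2 * ?B p - 2 * half p \<le> ix p i \<and> ix p i < 2 * ?B p \<and> ix p i < 2 * L"
    if "p \<in> long_legs" "i < len p" for p i
    using that Bge[of p] Ble[of p] half_pos[of p] long_len[of p] by (auto simp: ix_def)
  \<comment> \<open>Different legs occupy disjoint blocks of positions.\<close>
  have ixinj: "p = q \<and> i = j"
    if "p \<in> long_legs" "i < len p" "q \<in> long_legs" "j < len q" "ix p i = ix q j" for p q i j
  proof -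
    have "\<not> r p < r q"
      using cumulative_less[OF finite_long_legs that(3), of r p half] ixb[OF that(1,2)] ixb[OF that(3,4)] that(5)
      by linarith
    moreover have "\<not> r q < r p"
      using cumulative_less[OF finite_long_legs that(1), of r q half] ixb[OF that(1,2)] ixb[OF that(3,4)] that(5)
      by linarith
    ultimately have "p = q" using r that by (metis inj_onD linorder_neqE_nat)
    \<comment> \<open>This keeps the subtraction of natural numbers in \<open>ix\<close> from
      truncating.\<close>
    moreover have "i < 2 * ?B p" "j < 2 * ?B q"
      using that(1-4) Bge[of p] Bge[of q] long_len[of p] long_len[of q] by linarith+
    ultimately show ?thesis using that(5) by (simp add: ix_def)
  qed
  have tb: "k + 1 \<le> \<tau> n \<and> \<tau> n \<le> base + npend + int L" if "n < 2 * L" for n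
  proof (cases "even n")
    case True
    then have "n div 2 < L" using that by auto
    then show ?thesis using sb[of "n div 2"] h True by (simp add: \<tau>_def)
  next
    case False
    then have "n div 2 < L" using that by auto
    then show ?thesis using False base_nonneg by (simp add: \<tau>_def)
  qed
  have tinj: "n = m" if nm: "n < 2 * L" "m < 2 * L" "\<tau> n = \<tau> m" for n m
  proof -
    have *: "n div 2 < L" "m div 2 < L" using that by auto
    have "even n = even m"
      using nm(3) sb[OF *(1)] sb[OF *(2)] h by (auto simp: \<tau>_def split: if_splits)
    moreover have "n div 2 = m div 2"
      using calculation nm(3) smono[of "n div 2" "m div 2"] smono[of "m div 2" "n div 2"] *
      by (cases "n div 2" "m div 2" rule: linorder_cases) (auto simp: \<tau>_def split: if_splits)
    ultimately show ?thesis by (metis dvd_mult_div_cancel odd_two_times_div_two_succ)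
  qed
  have tS: "\<tau> n \<noteq> base + v p" if n: "n < 2 * L" and p: "p \<in> pendants" for n p
  proof (cases "even n")
    case True
    then have "n div 2 < L" using n by auto
    then show ?thesis using sS[of "n div 2"] p True by (auto simp: \<tau>_def S_def)
  next
    case False
    have "v p \<le> npend" using v(2) p by auto
    then show ?thesis using False by (simp add: \<tau>_def)
  qed
  have Acases: "p \<in> pendants \<and> len p = 1 \<or> p \<in> long_legs \<and> len p \<noteq> 1" if "p \<in> A" for p
    using that by (auto simp: pendants_def long_legs_def)
  have gi: "inj_on (\<lambda>(p, i). g p i) (SIGMA p:A. {..<len p})"
  proof (rule inj_onI, clarify)
    fix p i q j assume a: "p \<in> A" "i < len p" "q \<in> A" "j < len q" and eq: "g p i = g q j"
    show "p = q \<and> i = j"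
      using Acases[OF a(1)] Acases[OF a(3)]
    proof (elim disjE conjE)
      assume "p \<in> pendants" "len p = 1" "q \<in> pendants" "len q = 1"
      then show ?thesis using eq a v(1) by (auto simp: g_def inj_on_def)
    next
      assume *: "p \<in> pendants" "len p = 1" "q \<in> long_legs" "len q \<noteq> 1"
      then show ?thesis using eq tS[of "ix q j" p] ixb[OF *(3) a(4)] by (simp add: g_def)
    next
      assume *: "p \<in> long_legs" "len p \<noteq> 1" "q \<in> pendants" "len q = 1"
      then show ?thesis using eq tS[of "ix p i" q] ixb[OF *(1) a(2)] by (simp add: g_def)
    next
      assume *: "p \<in> long_legs" "len p \<noteq> 1" "q \<in> long_legs" "len q \<noteq> 1"
      then have "ix p i = ix q j"
        using eq ixb[OF *(1) a(2)] ixb[OF *(3) a(4)] by (intro tinj) (auto simp: g_def)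
      then show ?thesis using ixinj * a by blast
    qed
  qed
  have sumlen: "int (sum len A) = npend + 2 * int L"
  proof -
    have "A = pendants \<union> long_legs" "pendants \<inter> long_legs = {}" by (auto simp: pendants_def long_legs_def)
    then have "sum len A = sum len pendants + sum len long_legs"
      using finite_pendants finite_long_legs by (metis sum.union_disjoint)
    moreover have "sum len pendants = card pendants" by (simp add: pendants_def)
    moreover have "sum len long_legs = 2 * L" using long_len by (simp add: L_def sum_distrib_left)
    ultimately show ?thesis by (simp add: npend_def)
  qed
  have gb: "k + 1 \<le> g p i \<and> g p i \<le> k + int (sum len A)" if a: "p \<in> A" "i < len p" for p i
    using Acases[OF a(1)]
  proof (elim disjE conjE)
    assume "p \<in> pendants" "len p = 1"
    then have "1 - half_sum \<le> v p" "v p \<le> npend" "g p i = base + v p" using v(2) by (auto simp: g_def)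
    then show ?thesis using sumlen base_nonneg by (simp add: base_def hs)
  next
    assume "p \<in> long_legs" "len p \<noteq> 1"
    then show ?thesis using ixb[OF _ a(2)] tb[of "ix p i"] sumlen by (auto simp: g_def base_def hs)
  qed
  have gl: "g p (len p - 1) \<le> base + npend" if a: "p \<in> A" for p
    using Acases[OF a(1)]
  proof (elim disjE conjE)
    assume "p \<in> pendants" "len p = 1"
    then show ?thesis using v(2) by (auto simp: g_def)
  next
    assume p: "p \<in> long_legs" "len p \<noteq> 1"
    \<comment> \<open>Each leg fills a block of even length that starts at an even position, so the
      edge at its leaf gets a small label.\<close>
    have "ix p (len p - 1) = 2 * (?B p - half p)"
      using Bge[OF p(1)] half_pos[OF p(1)] long_len[OF p(1)] by (simp add: ix_def)
    moreover have "?B p - half p < L" using Ble[of p] Bge[OF p(1)] half_pos[OF p(1)] by linarith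
    ultimately show ?thesis using sb[of "?B p - half p"] h p by (simp add: g_def \<tau>_def)
  qed
  \<comment> \<open>Two adjacent positions carry one small and one large label. For even
    \<open>n\<close>, \<open>Suc n div 2\<close> equals \<open>n div 2\<close>, so the formula
    serves both parities.\<close>
  have t2: "\<tau> n + \<tau> (Suc n) = base + npend + 1 + int (n div 2) + s (Suc n div 2)" for n
    by (cases "even n") (auto simp: \<tau>_def)
  have g2: "p \<in> long_legs \<and> Suc (ix p (Suc i)) < 2 * L \<and>
      g p i + g p (Suc i) = \<tau> (ix p (Suc i)) + \<tau> (Suc (ix p (Suc i)))"
    if a: "p \<in> A" "Suc i < len p" for p i
  proof -
    have p: "p \<in> long_legs" "len p \<noteq> 1" using Acases[OF a(1)] a(2) by auto
    have "Suc (ix p (Suc i)) = ix p i"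
      using a(2) Bge[OF p(1)] long_len[OF p(1)] by (simp add: ix_def)
    then show ?thesis using p ixb[OF p(1), of i] a(2) by (simp add: g_def)
  qed
  have g2b: "base + npend < g p i + g p (Suc i) \<and> g p i + g p (Suc i) \<le> 3 * base + npend + h"
    if a: "p \<in> A" "Suc i < len p" for p i
  proof -
    let ?n = "ix p (Suc i)"
    have n: "Suc ?n div 2 < L" "?n div 2 < L" using g2[OF a] by auto
    show ?thesis using g2[OF a] sb[OF n(1)] n(2) t2[of ?n] k0 base_nonneg hs by linarith
  qed
  \<comment> \<open>When \<open>n\<close> grows by 1, exactly one of \<open>n div 2\<close> and
    \<open>Suc n div 2\<close> grows, so the sum strictly increases.\<close>
  have t2mono: "\<tau> n + \<tau> (Suc n) < \<tau> m + \<tau> (Suc m)" if "n < m" "Suc m < 2 * L" for n m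
  proof -
    have *: "n div 2 \<le> m div 2" "Suc n div 2 \<le> Suc m div 2" "Suc m div 2 < L" using that by auto
    have "n div 2 < m div 2 \<or> Suc n div 2 < Suc m div 2" using that(1) by presburger
    then show ?thesis unfolding t2
      using * smono[of "Suc n div 2" "Suc m div 2"] sle[of "Suc n div 2" "Suc m div 2"] by fastforce
  qed
  have g2i: "inj_on (\<lambda>(p, i). g p i + g p (Suc i)) {(p, i). p \<in> A \<and> Suc i < len p}"
  proof (rule inj_onI, clarify)
    fix p i q j assume a: "p \<in> A" "Suc i < len p" "q \<in> A" "Suc j < len q"
      and eq: "g p i + g p (Suc i) = g q j + g q (Suc j)"
    have "ix p (Suc i) = ix q (Suc j)"
      using eq g2[OF a(1,2)] g2[OF a(3,4)] t2mono[of "ix p (Suc i)" "ix q (Suc j)"]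
        t2mono[of "ix q (Suc j)" "ix p (Suc i)"]
      by (cases "ix p (Suc i)" "ix q (Suc j)" rule: linorder_cases) auto
    then show "p = q \<and> i = j"
      using ixinj[of p "Suc i" q "Suc j"] g2[OF a(1,2)] g2[OF a(3,4)] a by auto
  qed
  have g0: "(\<Sum>p | p \<in> A \<and> ctr p = c. g p 0) = center_sum v r c" for c
    unfolding center_sum_def
  proof (rule sum.cong)
    fix p assume "p \<in> {p. p \<in> A \<and> ctr p = c}"
    then have "p \<in> A" by simp
    from Acases[OF this] show "g p 0 = first_label v r p"
    proof (elim disjE conjE)
      assume p: "p \<in> long_legs" "len p \<noteq> 1"
      have "1 \<le> ?B p" using Bge[OF p(1)] half_pos[OF p(1)] by linarith
      \<comment> \<open>The edge at the center ends the block of its leg, at an odd position, and so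
        gets a large label.\<close>
      then have "ix p 0 = Suc (2 * (?B p - 1))" by (simp add: ix_def)
      then have "\<tau> (ix p 0) = base + npend + 1 + int (?B p - 1)" by (simp add: \<tau>_def)
      then show ?thesis using p \<open>1 \<le> ?B p\<close> by (simp add: g_def first_label_def reach_def)
    qed (simp add: g_def first_label_def)
  qed simp
  have le: "base + npend \<le> 3 * base + npend + h" using base_nonneg h by linarith
  show ?thesis
  proof (rule exI[of _ g], rule exI[of _ "base + npend"], rule exI[of _ "3 * base + npend + h"], unfold g0, intro conjI)
    show "inj_on (\<lambda>(p, i). g p i) (SIGMA p:A. {..<len p})" by (rule gi)
    show "\<forall>p\<in>A. \<forall>i<len p. k + 1 \<le> g p i \<and> g p i \<le> k + int (sum len A)" using gb by blast
    show "\<forall>p\<in>A. g p (len p - 1) \<le> base + npend" using gl by blast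
    show "\<forall>p\<in>A. \<forall>i. Suc i < len p \<longrightarrow> base + npend < g p i + g p (Suc i) \<and>
        g p i + g p (Suc i) \<le> 3 * base + npend + h" using g2b by blast
    show "inj_on (\<lambda>(p, i). g p i + g p (Suc i)) {(p, i). p \<in> A \<and> Suc i < len p}" by (rule g2i)
    show "\<forall>c\<in>ctr ` A. base + npend < center_sum v r c \<and> 3 * base + npend + h < center_sum v r c"
      using cs(2) le by (meson order_le_less_trans)
    show "inj_on (center_sum v r) (ctr ` A)" by (rule cs(1))
  qed
qed

end

section \<open>Legs of a spider forest\<close>

lemma is_walk_iff_nth:
  "is_walk V E p \<longleftrightarrow> p \<noteq> [] \<and> set p \<subseteq> V \<and> (\<forall>i. Suc i < length p \<longrightarrow> {p ! i, p ! Suc i} \<in> E)"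
  by (auto simp: is_walk_def successively_conv_nth)

text \<open>Cutting out the stretch between two occurrences of a vertex shortens the walk and keeps
  its ends.\<close>

lemma walk_to_path:
  assumes "is_walk V E p"
  shows "\<exists>q. is_path V E q \<and> hd q = hd p \<and> last q = last p"
  using assms
proof (induction "length p" arbitrary: p rule: less_induct)
  case less
  show ?case
  proof (cases "distinct p")
    case True
    then show ?thesis using less.prems by (auto simp: is_path_def)
  next
    case False
    then obtain xs ys zs y where p: "p = xs @ [y] @ ys @ [y] @ zs" using not_distinct_decomp by blast
    let ?q = "xs @ [y] @ zs"
    have "is_walk V E ?q" using less.prems
      by (auto simp: p is_walk_def successively_append_iff successively_Cons)
    moreover have "hd ?q = hd p" "last ?q = last p" by (auto simp: p hd_append)
    ultimately show ?thesis using less.hyps[of ?q] by (auto simp: p)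
  qed
qed

lemma reachable_sym: "reachable V E u v \<Longrightarrow> reachable V E v u"
proof -
  assume "reachable V E u v"
  then obtain p where "is_walk V E p" "hd p = u" "last p = v" by (auto simp: reachable_def)
  then have "is_walk V E (rev p)" "hd (rev p) = v" "last (rev p) = u"
    by (auto simp: is_walk_def hd_rev last_rev insert_commute)
  then show ?thesis unfolding reachable_def by blast
qed

lemma reachable_trans:
  assumes "reachable V E u v" "reachable V E v w"
  shows "reachable V E u w"
proof -
  obtain p q where pq: "is_walk V E p" "hd p = u" "last p = v" "is_walk V E q" "hd q = v" "last q = w"
    using assms by (auto simp: reachable_def)
  then obtain q' where q: "q = v # q'" by (cases q) (auto simp: is_walk_def)
  have "is_walk V E (p @ q')" using pq
    by (cases q') (auto simp: is_walk_def successively_append_iff q)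
  moreover have "hd (p @ q') = u" "last (p @ q') = w" using pq by (auto simp: is_walk_def q)
  ultimately show ?thesis unfolding reachable_def by blast
qed

lemma reachable_refl: "v \<in> V \<Longrightarrow> reachable V E v v"
  unfolding reachable_def by (rule exI[of _ "[v]"]) (simp add: is_walk_def)

lemma reachable_edge: "u \<in> V \<Longrightarrow> v \<in> V \<Longrightarrow> {u, v} \<in> E \<Longrightarrow> reachable V E u v"
  unfolding reachable_def by (rule exI[of _ "[u, v]"]) (simp add: is_walk_def)

lemma components_eq:
  assumes "C \<in> components V E" "D \<in> components V E" "x \<in> C" "x \<in> D"
  shows "C = D"
proof -
  obtain v w where "C = {u. reachable V E v u}" "D = {u. reachable V E w u}"
    using assms by (auto simp: components_def)
  moreover have "reachable V E v w" "reachable V E w v"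
    using calculation assms(3,4) by (auto intro: reachable_sym reachable_trans)
  ultimately show ?thesis by (auto intro: reachable_trans)
qed

lemma component_subset: "C \<in> components V E \<Longrightarrow> C \<subseteq> V"
  by (auto simp: components_def reachable_def is_walk_def)

lemma vertex_in_component: "v \<in> V \<Longrightarrow> \<exists>C\<in>components V E. v \<in> C"
  using reachable_refl[of v V E] unfolding components_def by blast

lemma edge_doubleton:
  assumes "simple_graph V E" "e \<in> E"
  obtains u v where "e = {u, v}" "u \<noteq> v" "u \<in> V" "v \<in> V"
  using assms by (auto simp: simple_graph_def card_2_iff)

lemma edge_in_component:
  assumes "simple_graph V E" "e \<in> E"
  shows "\<exists>C\<in>components V E. e \<in> induced_edges E C"
proof -
  obtain u v where e: "e = {u, v}" "u \<in> V" "v \<in> V" using assms edge_doubleton by metis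
  let ?C = "{x. reachable V E u x}"
  have "?C \<in> components V E" using e by (auto simp: components_def)
  moreover have "e \<in> induced_edges E ?C"
    using e assms reachable_refl[of u] reachable_edge[of u V v] by (auto simp: induced_edges_def)
  ultimately show ?thesis by blast
qed

lemma simple_graph_finite_edges: "simple_graph V E \<Longrightarrow> finite E"
  by (rule finite_subset[of _ "Pow V"]) (auto simp: simple_graph_def)

lemma is_path_nth:
  assumes "is_path V E p" "Suc i < length p"
  shows "{p ! i, p ! Suc i} \<in> E"
  using assms by (auto simp: is_path_def is_walk_iff_nth)

lemma internal_degree:
  assumes "simple_graph V E" "is_path V E p" "Suc (Suc i) < length p"
  shows "2 \<le> degree E (p ! Suc i)"
proof -
  let ?a = "{p ! i, p ! Suc i}" and ?b = "{p ! Suc i, p ! Suc (Suc i)}"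
  have d: "distinct p" using assms by (simp add: is_path_def)
  then have "p ! i \<noteq> p ! Suc i" "p ! i \<noteq> p ! Suc (Suc i)" using assms by (simp_all add: nth_eq_iff_index_eq)
  then have "?a \<noteq> ?b" by (auto simp: doubleton_eq_iff)
  moreover have "?a \<in> E" "?b \<in> E" using assms is_path_nth[OF assms(2)] by auto
  ultimately have "card {?a, ?b} \<le> card {e \<in> E. p ! Suc i \<in> e}"
    using simple_graph_finite_edges[OF assms(1)] by (intro card_mono) auto
  then show ?thesis using \<open>?a \<noteq> ?b\<close> by (simp add: degree_def)
qed

section \<open>The legs of a single spider\<close>

context
  fixes V :: "'a set" and E :: "'a set set" and c :: 'a
  assumes sp: "is_spider V E" and cen: "is_center V E c"
begin

lemma spider_simple: "simple_graph V E" and spider_acyclic: "\<not> is_cycle V E p" and spider_connected: "connected_graph V E"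
  using sp by (auto simp: is_spider_def is_tree_def)

lemma center_unique: "x \<in> V \<Longrightarrow> 2 < degree E x \<Longrightarrow> x = c"
  using sp cen unfolding is_spider_def is_center_def by blast

text \<open>An edge from the end of a path back to any earlier vertex but its predecessor closes a
  cycle with the final segment of the path.\<close>

lemma chord_is_last_step:
  assumes "is_path V E q" "i < length q" "{last q, q ! i} \<in> E"
  shows "Suc (Suc i) = length q"
proof (rule ccontr)
  assume n: "Suc (Suc i) \<noteq> length q"
  have q: "q \<noteq> []" "distinct q" "set q \<subseteq> V" using assms by (auto simp: is_path_def is_walk_def)
  have "i \<noteq> length q - 1"
  proof
    assume "i = length q - 1"
    then have "{last q} \<in> E" using assms q by (simp add: last_conv_nth)
    then show False using spider_simple by (auto simp: simple_graph_def)
  qed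
  then have l: "3 \<le> length (drop i q)" using n assms(2) by simp
  have "is_path V E (drop i q)"
    using assms by (auto simp: is_path_def is_walk_iff_nth dest: in_set_dropD)
  then have "is_cycle V E (drop i q)" using l assms by (simp add: is_cycle_def hd_drop_conv_nth)
  then show False using spider_acyclic by blast
qed

text \<open>In a longest extension, a further edge at the end would either lengthen the path or be a
  chord. So the end is a leaf.\<close>

lemma path_extends_to_leg:
  assumes q: "is_path V E q" "hd q = c" "2 \<le> length q"
  shows "\<exists>r. is_leg V E (q @ r)"
proof -
  let ?S = "{r. is_path V E (q @ r)}"
  have bnd: "length r \<le> card V" if "r \<in> ?S" for r
  proof -
    have "length (q @ r) = card (set (q @ r))" using that by (metis distinct_card is_path_def mem_Collect_eq)
    also have "\<dots> \<le> card V" using that spider_simple by (intro card_mono) (auto simp: is_path_def is_walk_def simple_graph_def)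
    finally show ?thesis by simp
  qed
  have "[] \<in> ?S" using q by simp
  then have "\<exists>r. r \<in> ?S \<and> (\<forall>s. s \<in> ?S \<longrightarrow> length s \<le> length r)"
    using bnd by (intro ex_has_greatest_nat[where b = "Suc (card V)" and k = "[]"]) (auto simp: less_Suc_eq_le)
  then obtain r where r: "r \<in> ?S" "\<And>s. s \<in> ?S \<Longrightarrow> length s \<le> length r" by blast
  let ?p = "q @ r" and ?x = "last (q @ r)" and ?n = "length (q @ r)"
  have p: "is_path V E ?p" "hd ?p = c" "2 \<le> ?n" using r q by (auto simp: hd_append)
  have pn: "?p \<noteq> []" using q by auto
  have sn: "Suc (?n - 2) = ?n - 1" using p(3) by linarith
  have xl: "?x = ?p ! Suc (?n - 2)" unfolding sn using pn by (rule last_conv_nth)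
  let ?e = "{?p ! (?n - 2), ?x}"
  have eE: "?e \<in> E" unfolding xl by (rule is_path_nth[OF p(1)]) (use p(3) in linarith)
  have xV: "?x \<in> V" using p(1) pn by (metis is_path_def is_walk_def last_in_set subsetD)
  have "e = ?e" if e: "e \<in> E" "?x \<in> e" for e
  proof -
    obtain y where y: "e = {?x, y}" "y \<in> V"
    proof -
      obtain a b where "e = {a, b}" "a \<in> V" "b \<in> V" using edge_doubleton[OF spider_simple e(1)] by metis
      then show ?thesis using that[of a] that[of b] e(2) by (auto simp: insert_commute)
    qed
    have "y \<in> set ?p"
    proof (rule ccontr)
      assume ny: "y \<notin> set ?p"
      have "successively (\<lambda>u v. {u, v} \<in> E) ((q @ r) @ [y])" using p(1) y e pn
        by (subst successively_append_iff) (simp add: is_path_def is_walk_def)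
      then have "is_path V E (?p @ [y])" using p(1) ny y by (simp add: is_path_def is_walk_def)
      then have "r @ [y] \<in> ?S" by simp
      then show False using r(2)[of "r @ [y]"] by simp
    qed
    then obtain i where i: "i < ?n" "?p ! i = y" by (metis in_set_conv_nth)
    then have "Suc (Suc i) = ?n" using chord_is_last_step[OF p(1), of i] e y by simp
    then have "i = ?n - 2" by linarith
    then show ?thesis using i y by (auto simp: insert_commute)
  qed
  moreover have "?x \<in> ?e" by blast
  ultimately have "{e \<in> E. ?x \<in> e} = {?e}" using eE by blast
  then have "is_leaf V E ?x" using xV by (simp add: is_leaf_def degree_def)
  then have "is_leg V E ?p" unfolding is_leg_def p(2) using p(1) cen by blast
  then show ?thesis ..
qed

lemma leg_hd: "is_leg V E p \<Longrightarrow> hd p = c"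
  by (rule center_unique) (simp_all add: is_leg_def is_center_def)

lemma leg_length: "is_leg V E p \<Longrightarrow> 2 \<le> length p"
proof (rule ccontr)
  assume p: "is_leg V E p" "\<not> 2 \<le> length p"
  then have "p \<noteq> []" by (simp add: is_leg_def is_path_def is_walk_def)
  then have "hd p = last p" using p(2) by (cases p; cases "tl p") simp_all
  then show False using p(1) by (auto simp: is_leg_def is_center_def is_leaf_def)
qed

lemma center_reaches: "v \<in> V \<Longrightarrow> \<exists>q. is_path V E q \<and> hd q = c \<and> last q = v"
proof -
  assume "v \<in> V"
  then obtain p where "is_walk V E p" "hd p = c" "last p = v"
    using spider_connected cen unfolding connected_graph_def is_center_def reachable_def by blast
  then show ?thesis using walk_to_path by metis
qed

text \<open>Take a path from the center to one end of \<open>e\<close>. If the other end lies on it,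
  \<open>e\<close> is its last step; otherwise that end can be appended. The path then extends to a
  leg.\<close>

lemma edge_on_leg:
  assumes e: "e \<in> E"
  shows "\<exists>p i. is_leg V E p \<and> Suc i < length p \<and> e = {p ! i, p ! Suc i}"
proof -
  obtain u v where uv: "e = {u, v}" "u \<noteq> v" "u \<in> V" "v \<in> V" using edge_doubleton[OF spider_simple e] by metis
  obtain q where q: "is_path V E q" "hd q = c" "last q = v" using center_reaches uv by blast
  have qn: "q \<noteq> []" using q by (auto simp: is_path_def is_walk_def)
  obtain q' i where q': "is_path V E q'" "hd q' = c" "Suc i < length q'" "e = {q' ! i, q' ! Suc i}"
  proof (cases "u \<in> set q")
    case True
    then obtain i where i: "i < length q" "q ! i = u" by (metis in_set_conv_nth)
    then have "Suc (Suc i) = length q" using chord_is_last_step[OF q(1), of i] q e uv by (simp add: insert_commute)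
    moreover from this have "q ! Suc i = v" using q qn by (metis diff_Suc_1 last_conv_nth)
    ultimately show ?thesis using that[of q i] q i uv by auto
  next
    case False
    then have "is_path V E (q @ [u])" using q uv e qn
      by (auto simp: is_path_def is_walk_def successively_append_iff insert_commute)
    then show ?thesis using that[of "q @ [u]" "length q - 1"] q uv qn
      by (auto simp: nth_append last_conv_nth insert_commute)
  qed
  then obtain r where "is_leg V E (q' @ r)" using path_extends_to_leg[of q'] by auto
  then show ?thesis using q' by (intro exI[of _ "q' @ r"] exI[of _ i]) (auto simp: nth_append)
qed

text \<open>No leg is a proper prefix of another, since a leaf is not an inner vertex of a path.
  Where the two legs part beyond the first vertex, three edges would meet; that vertex would be the
  center, which occurs only at the start.\<close>

lemma legs_diverge_at_center:
  assumes p: "is_leg V E p" and q: "is_leg V E q" and ne: "p \<noteq> q"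
  shows "p ! 1 \<noteq> q ! 1"
proof -
  have P: "is_path V E p" "is_path V E q" using p q by (auto simp: is_leg_def)
  have np: "\<not> strict_prefix p q" if p: "is_leg V E p" and q: "is_leg V E q" for p q
  proof
    assume "strict_prefix p q"
    then obtain z zs where z: "q = p @ z # zs" by (rule strict_prefixE')
    have l: "2 \<le> length p" using leg_length p by blast
    define i where "i = length p - 2"
    have "2 \<le> degree E (q ! Suc i)"
      using internal_degree[OF spider_simple, of q i] q l z by (simp add: is_leg_def i_def)
    moreover have "Suc i = length p - 1" "p \<noteq> []" using l by (auto simp: i_def)
    then have "q ! Suc i = last p" by (simp add: z nth_append last_conv_nth)
    ultimately show False using p by (auto simp: is_leg_def is_leaf_def)
  qed
  have "p \<parallel> q" using np[OF p q] np[OF q p] ne by (auto simp: strict_prefix_def)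
  then obtain as a bs b cs where d: "a \<noteq> b" "p = as @ a # bs" "q = as @ b # cs"
    using parallel_decomp by blast
  have "as \<noteq> []" using d leg_hd[OF p] leg_hd[OF q] by auto
  have "length as = 1"
  proof (rule ccontr)
    assume "length as \<noteq> 1"
    then obtain xs y x where as: "as = xs @ [y, x]"
      using \<open>as \<noteq> []\<close> by (metis One_nat_def append.assoc append_Cons append_Nil length_Cons list.size(3) rev_exhaust)
    have E3: "{y, x} \<in> E" "{x, a} \<in> E" "{x, b} \<in> E"
      using P by (auto simp: is_path_def is_walk_def d as successively_append_iff)
    have "distinct p" "distinct q" using P by (auto simp: is_path_def)
    then have nn: "y \<noteq> a" "y \<noteq> b" "x \<noteq> y" "x \<noteq> a" "x \<noteq> b" by (auto simp: d as)
    then have "card {{y, x}, {x, a}, {x, b}} = 3" using d by (auto simp: doubleton_eq_iff card_insert_if)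
    moreover have "card {{y, x}, {x, a}, {x, b}} \<le> degree E x"
      unfolding degree_def using E3 simple_graph_finite_edges[OF spider_simple] by (intro card_mono) auto
    moreover have "x \<in> V" using P by (auto simp: is_path_def is_walk_def d as)
    ultimately have "x = c" using center_unique by auto
    moreover have "hd p = c" using leg_hd p by blast
    ultimately show False using \<open>distinct p\<close> by (cases xs) (auto simp: d as)
  qed
  then show ?thesis using d by (auto simp: nth_append)
qed

text \<open>If distinct legs met again, following \<open>p\<close> to the first common vertex after
  the center and returning along \<open>q\<close> would give a cycle. It has at least three vertices
  because the second vertices of the legs differ.\<close>

lemma legs_meet_only_at_center:
  assumes p: "is_leg V E p" and q: "is_leg V E q"
    and ij: "0 < i" "i < length p" "j < length q" "p ! i = q ! j"
  shows "p = q \<and> i = j"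
proof (cases "p = q")
  case True
  then show ?thesis using assms by (auto simp: is_leg_def is_path_def nth_eq_iff_index_eq)
next
  case False
  have P: "is_path V E p" "is_path V E q" "distinct p" "distinct q"
    using p q by (auto simp: is_leg_def is_path_def)
  have ne: "p \<noteq> []" "q \<noteq> []" using P by (auto simp: is_path_def is_walk_def)
  have hd0: "p ! 0 = c" "q ! 0 = c" using leg_hd p q ne by (metis hd_conv_nth)+
  let ?Q = "\<lambda>i. 0 < i \<and> i < length p \<and> p ! i \<in> set q"
  define n where "n = (LEAST i. ?Q i)"
  have "?Q i" using ij by auto
  then have n: "?Q n" "\<And>m. m < n \<Longrightarrow> \<not> ?Q m"
    unfolding n_def by (rule LeastI, metis not_less_Least)
  then obtain t where t: "t < length q" "q ! t = p ! n" by (metis in_set_conv_nth)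
  have t0: "0 < t"
  proof (rule ccontr)
    assume "\<not> 0 < t"
    then have "p ! n = p ! 0" using t hd0 by simp
    then show False using n P ne nth_eq_iff_index_eq[of p n 0] by auto
  qed
  have nt: "3 \<le> n + t"
  proof (rule ccontr)
    assume "\<not> 3 \<le> n + t"
    then have "n = 1" "t = 1" using n t0 by auto
    then show False using legs_diverge_at_center[OF p q False] t by simp
  qed
  \<comment> \<open>\<open>tl q\<close> omits the center, which already heads the list, and
    \<open>t - 1\<close> stops short of the meeting vertex. The way back is
    \<open>q ! (t - 1)\<close> down to \<open>q ! 1\<close>.\<close>
  let ?z = "take (Suc n) p @ rev (take (t - 1) (tl q))"
  have lenz: "length ?z = n + t" using n t t0 by simp
  have nth1: "?z ! s = p ! s" if "s \<le> n" for s using that n by (simp add: nth_append)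
  \<comment> \<open>The range includes \<open>s = n\<close>, where \<open>q ! t = p ! n\<close>, so
    that the edge at the turn is treated like the others on \<open>q\<close>.\<close>
  have nth2: "?z ! s = q ! (n + t - s)" if "n \<le> s" "s < n + t" for s
  proof (cases "s = n")
    case True
    then show ?thesis using nth1 t by simp
  next
    case False
    then have "?z ! s = rev (take (t - 1) (tl q)) ! (s - Suc n)" using that n by (simp add: nth_append)
    also have "\<dots> = take (t - 1) (tl q) ! (t - 1 - Suc (s - Suc n))"
      using that t False by (subst rev_nth) auto
    also have "\<dots> = q ! (n + t - s)" using that t False by (auto simp: nth_tl intro!: arg_cong[of _ _ "nth q"])
    finally show ?thesis .
  qed
  have dist: "distinct ?z"
  proof -
    have "set (take (Suc n) p) \<inter> set (take (t - 1) (tl q)) = {}"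
    proof (rule ccontr)
      assume "\<not> ?thesis"
      then obtain x where x: "x \<in> set (take (Suc n) p)" "x \<in> set (take (t - 1) (tl q))" by blast
      obtain s where s: "s \<le> n" "x = p ! s" "s < length p" using x(1) by (auto simp: in_set_conv_nth less_Suc_eq_le)
      obtain s' where s': "s' < t - 1" "s' < length (tl q)" "x = q ! Suc s'"
        using x(2) by (auto simp: in_set_conv_nth nth_tl)
      have "x \<in> set q" using s' by auto
      then have "s = 0 \<or> s = n" using n(2)[of s] s by auto
      then show False
      proof
        assume "s = 0"
        then have "q ! Suc s' = q ! 0" using s s' hd0 by simp
        then show False using P s' nth_eq_iff_index_eq[of q "Suc s'" 0] ne t by (auto simp: nth_eq_iff_index_eq)
      next
        assume "s = n"
        then have "q ! Suc s' = q ! t" using s s' t by simp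
        then show False using P s' t nth_eq_iff_index_eq[of q "Suc s'" t] by auto
      qed
    qed
    then show ?thesis using P by (auto simp: distinct_tl)
  qed
  have "is_walk V E ?z"
    unfolding is_walk_iff_nth
  proof (intro conjI allI impI)
    show "?z \<noteq> []" using ne by simp
    have "set ?z \<subseteq> set p \<union> set q"
      using set_take_subset[of "Suc n" p] set_take_subset[of "t - 1" "tl q"] set_mono_suffix[OF suffix_tl, of q]
      by auto
    then show "set ?z \<subseteq> V" using P by (auto simp: is_path_def is_walk_def)
    fix s assume s: "Suc s < length ?z"
    show "{?z ! s, ?z ! Suc s} \<in> E"
    proof (cases "s < n")
      case True
      then show ?thesis using nth1[of s] nth1[of "Suc s"] is_path_nth[OF P(1), of s] n by simp
    next
      case False
      have *: "Suc (n + t - Suc s) = n + t - s" using s lenz by simp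
      have "{q ! (n + t - Suc s), q ! (n + t - s)} \<in> E"
        using is_path_nth[OF P(2), of "n + t - Suc s"] t False lenz unfolding * by simp
      then show ?thesis using nth2[of s] nth2[of "Suc s"] False s lenz by (simp add: insert_commute)
    qed
  qed
  moreover have "last ?z = q ! 1"
  proof -
    have "last ?z = ?z ! (n + t - 1)" unfolding lenz[symmetric] by (rule last_conv_nth) (use ne in simp)
    also have "\<dots> = q ! 1" using nth2[of "n + t - 1"] t0 nt by simp
    finally show ?thesis .
  qed
  moreover have "hd ?z = c" using nth1[of 0] hd0 ne by (simp add: hd_conv_nth)
  moreover have "{q ! 1, c} \<in> E"
    using is_path_nth[OF P(2), of 0] leg_length[OF q] hd0 by (simp add: insert_commute)
  ultimately have "is_cycle V E ?z" using dist lenz nt by (simp add: is_cycle_def is_path_def)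
  then show ?thesis using spider_acyclic by blast
qed

lemma finite_legs: "finite {p. is_leg V E p}"
proof (rule finite_subset)
  show "{p. is_leg V E p} \<subseteq> {p. set p \<subseteq> V \<and> length p \<le> card V}"
  proof safe
    fix p x assume p: "is_leg V E p"
    then have d: "distinct p" "set p \<subseteq> V" by (auto simp: is_leg_def is_path_def is_walk_def)
    then show "x \<in> set p \<Longrightarrow> x \<in> V" by auto
    show "length p \<le> card V" using d spider_simple by (metis card_mono distinct_card simple_graph_def)
  qed
  show "finite {p. set p \<subseteq> V \<and> length p \<le> card V}"
    using spider_simple finite_lists_length_le by (auto simp: simple_graph_def)
qed

text \<open>Every edge at the center is the first step of some leg, so the legs map onto more than
  two edges.\<close>

lemma at_least_three_legs: "3 \<le> card {p. is_leg V E p}"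
proof -
  have "{e \<in> E. c \<in> e} \<subseteq> (\<lambda>p. {p ! 0, p ! 1}) ` {p. is_leg V E p}"
  proof
    fix e assume "e \<in> {e \<in> E. c \<in> e}"
    then obtain p i where p: "is_leg V E p" "Suc i < length p" "e = {p ! i, p ! Suc i}" "c \<in> e"
      using edge_on_leg by blast
    have "p ! 0 = c" using leg_hd[OF p(1)] p(2) by (metis hd_conv_nth list.size(3) not_less_zero)
    then have "p ! 0 = p ! i \<or> p ! 0 = p ! Suc i" using p(3,4) by simp
    moreover have "distinct p" "0 < length p" "i < length p" using p(1,2) by (simp_all add: is_leg_def is_path_def is_walk_def)
    ultimately have "i = 0" using p(2) by (metis nat.distinct(1) nth_eq_iff_index_eq)
    then show "e \<in> (\<lambda>p. {p ! 0, p ! 1}) ` {p. is_leg V E p}" using p(1,3) by simp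
  qed
  then have "degree E c \<le> card {p. is_leg V E p}"
    unfolding degree_def using finite_legs by (rule surj_card_le[rotated])
  then show ?thesis using cen by (simp add: is_center_def)
qed

lemma vertex_on_leg:
  assumes "v \<in> V"
  shows "\<exists>p. is_leg V E p \<and> v \<in> set p"
proof -
  have "\<exists>p. is_leg V E p" using at_least_three_legs by (metis card.empty empty_Collect_eq not_numeral_le_zero)
  show ?thesis
  proof (cases "v = c")
    case True
    obtain p where p: "is_leg V E p" using \<open>\<exists>p. is_leg V E p\<close> by blast
    then have "hd p \<in> set p" using leg_length[OF p] by (intro hd_in_set) auto
    then show ?thesis using p leg_hd[OF p] True by blast
  next
    case False
    obtain q where q: "is_path V E q" "hd q = c" "last q = v" using center_reaches assms by blast
    then have "2 \<le> length q" using False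
      by (cases q; cases "tl q") (auto simp: is_path_def is_walk_def)
    then obtain r where "is_leg V E (q @ r)" using path_extends_to_leg q by blast
    then show ?thesis using q by (metis UnCI is_path_def is_walk_def last_in_set set_append)
  qed
qed

end

section \<open>The legs of all components together\<close>

definition forest_legs :: "'a set \<Rightarrow> 'a set set \<Rightarrow> 'a list set" where
  "forest_legs V E = {p. \<exists>C\<in>components V E. is_leg C (induced_edges E C) p}"

context
  fixes V :: "'a set" and E :: "'a set set"
  assumes forest: "is_spider_forest V E"
begin

lemma component_spider:
  assumes "C \<in> components V E"
  shows "is_spider C (induced_edges E C)" "\<exists>c. is_center C (induced_edges E C) c"
proof -
  show s: "is_spider C (induced_edges E C)" using assms forest by (simp add: is_spider_forest_def)
  then obtain c where "c \<in> C" "2 < degree (induced_edges E C) c" unfolding is_spider_def by blast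
  then show "\<exists>c. is_center C (induced_edges E C) c" using s unfolding is_center_def by blast
qed

lemma leg_in_component: "is_leg C F p \<Longrightarrow> p \<noteq> [] \<and> set p \<subseteq> C"
  by (auto simp: is_leg_def is_path_def is_walk_def)

lemma forest_leg_length: "p \<in> forest_legs V E \<Longrightarrow> 2 \<le> length p"
proof -
  assume "p \<in> forest_legs V E"
  then obtain C where C: "C \<in> components V E" "is_leg C (induced_edges E C) p"
    by (auto simp: forest_legs_def)
  then show ?thesis using component_spider[OF C(1)] leg_length by metis
qed

lemma forest_leg_edge: "p \<in> forest_legs V E \<Longrightarrow> Suc i < length p \<Longrightarrow> {p ! i, p ! Suc i} \<in> E"
proof -
  assume "p \<in> forest_legs V E" "Suc i < length p"
  then obtain C where "{p ! i, p ! Suc i} \<in> induced_edges E C"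
    using is_path_nth unfolding forest_legs_def is_leg_def by blast
  then show ?thesis by (simp add: induced_edges_def)
qed

lemma forest_edge_on_leg:
  assumes "e \<in> E"
  shows "\<exists>p\<in>forest_legs V E. \<exists>i. Suc i < length p \<and> e = {p ! i, p ! Suc i}"
proof -
  obtain C where C: "C \<in> components V E" "e \<in> induced_edges E C"
    using edge_in_component forest assms by (metis is_spider_forest_def)
  obtain c where "is_center C (induced_edges E C) c" using component_spider[OF C(1)] by blast
  then obtain p i where "is_leg C (induced_edges E C) p" "Suc i < length p" "e = {p ! i, p ! Suc i}"
    using edge_on_leg component_spider[OF C(1)] C(2) by metis
  then show ?thesis using C(1) by (auto simp: forest_legs_def)
qed

lemma forest_vertex_on_leg:
  assumes "v \<in> V"
  shows "\<exists>p\<in>forest_legs V E. v \<in> set p"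
proof -
  obtain C where C: "C \<in> components V E" "v \<in> C" using vertex_in_component[OF assms] by blast
  obtain c where "is_center C (induced_edges E C) c" using component_spider[OF C(1)] by blast
  then obtain p where "is_leg C (induced_edges E C) p" "v \<in> set p"
    using vertex_on_leg component_spider[OF C(1)] C(2) by metis
  then show ?thesis using C(1) by (auto simp: forest_legs_def)
qed

text \<open>A common vertex puts both legs in the same component. Thus a vertex that is not a center
  determines its leg and its position there, which makes edges and incidences computable from the
  legs.\<close>

lemma forest_legs_meet:
  assumes "p \<in> forest_legs V E" "q \<in> forest_legs V E"
    and "0 < i" "i < length p" "j < length q" "p ! i = q ! j"
  shows "p = q \<and> i = j"
proof -
  obtain C D where C: "C \<in> components V E" "is_leg C (induced_edges E C) p"
    and D: "D \<in> components V E" "is_leg D (induced_edges E D) q"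
    using assms by (auto simp: forest_legs_def)
  have "p ! i \<in> C" "p ! i \<in> D" using leg_in_component C D assms by (metis nth_mem subsetD)+
  then have "C = D" using components_eq C D by metis
  obtain c where "is_center C (induced_edges E C) c" using component_spider[OF C(1)] by blast
  then show ?thesis
    using legs_meet_only_at_center[OF component_spider(1)[OF C(1)]] C D(2) assms(3-6) \<open>C = D\<close> by metis
qed

lemma finite_forest_legs: "finite (forest_legs V E)"
proof -
  have "components V E \<subseteq> Pow V" using component_subset by auto
  then have "finite (components V E)"
    using forest by (meson finite_Pow_iff finite_subset is_spider_forest_def simple_graph_def)
  moreover have "forest_legs V E = (\<Union>C\<in>components V E. {p. is_leg C (induced_edges E C) p})"
    by (auto simp: forest_legs_def)
  moreover have "finite {p. is_leg C (induced_edges E C) p}" if C: "C \<in> components V E" for C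
  proof -
    obtain c where "is_center C (induced_edges E C) c" using component_spider[OF C] by blast
    then show ?thesis using finite_legs[OF component_spider(1)[OF C]] by blast
  qed
  ultimately show ?thesis by auto
qed

lemma forest_center_three_legs:
  assumes "p \<in> forest_legs V E"
  shows "3 \<le> card {q \<in> forest_legs V E. hd q = hd p}"
proof -
  obtain C where C: "C \<in> components V E" "is_leg C (induced_edges E C) p"
    using assms by (auto simp: forest_legs_def)
  obtain c where c: "is_center C (induced_edges E C) c" using component_spider C by blast
  have "{q. is_leg C (induced_edges E C) q} \<subseteq> {q \<in> forest_legs V E. hd q = hd p}"
    using leg_hd[OF component_spider(1)[OF C(1)] c] C by (auto simp: forest_legs_def)
  then have "card {q. is_leg C (induced_edges E C) q} \<le> card {q \<in> forest_legs V E. hd q = hd p}"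
    using finite_forest_legs by (intro card_mono) auto
  then show ?thesis using at_least_three_legs[OF component_spider(1)[OF C(1)] c] by simp
qed

end

section \<open>The labeling of the forest\<close>

theorem theorem3:
  fixes V :: "'a set" and E :: "'a set set"
  assumes "is_spider_forest V E"
    and "\<And>C p. C \<in> components V E \<Longrightarrow> is_leg C (induced_edges E C) p \<Longrightarrow>
           path_length p = 1 \<or> even (path_length p)"
  shows "\<forall>k::int. k \<ge> 0 \<longrightarrow> shifted_antimagic V E k"
proof (intro allI impI)
  fix k :: int
  assume k: "0 \<le> k"
  note forest = assms(1)
  let ?A = "forest_legs V E"
  have two: "2 \<le> length p" if "p \<in> ?A" for p using forest_leg_length[OF forest that] .
  have nth0: "hd p = p ! 0" if "p \<in> ?A" for p
    using two[OF that] by (intro hd_conv_nth) auto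
  have len: "path_length p = 1 \<or> even (path_length p) \<and> 0 < path_length p" if "p \<in> ?A" for p
  proof -
    have "0 < path_length p" using two[OF that] by (simp add: path_length_def)
    moreover have "path_length p = 1 \<or> even (path_length p)"
      using that assms(2) unfolding forest_legs_def by blast
    ultimately show ?thesis by blast
  qed
  \<comment> \<open>The legs themselves serve as the index set, with \<open>hd\<close> giving the
    center and \<open>path_length\<close> the length.\<close>
  obtain g :: "'a list \<Rightarrow> nat \<Rightarrow> int" and m1 m2
    where ginj: "inj_on (\<lambda>(p, i). g p i) (SIGMA p:?A. {..<path_length p})"
      and gb: "\<forall>p\<in>?A. \<forall>i<path_length p. k + 1 \<le> g p i \<and> g p i \<le> k + int (sum path_length ?A)"
      and leaf: "\<forall>p\<in>?A. g p (path_length p - 1) \<le> m1"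
      and mid: "\<forall>p\<in>?A. \<forall>i. Suc i < path_length p \<longrightarrow>
          m1 < g p i + g p (Suc i) \<and> g p i + g p (Suc i) \<le> m2"
      and midinj: "inj_on (\<lambda>(p, i). g p i + g p (Suc i)) {(p, i). p \<in> ?A \<and> Suc i < path_length p}"
      and cen: "\<forall>c\<in>hd ` ?A. m1 < (\<Sum>p | p \<in> ?A \<and> hd p = c. g p 0) \<and>
          m2 < (\<Sum>p | p \<in> ?A \<and> hd p = c. g p 0)"
      and ceninj: "inj_on (\<lambda>c. \<Sum>p | p \<in> ?A \<and> hd p = c. g p 0) (hd ` ?A)"
    by (rule exE[OF leg_labeling[of ?A path_length hd k]], rule finite_forest_legs[OF forest], erule len,
        erule forest_center_three_legs[OF forest], rule k, elim exE conjE, rule that)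
  define slots where "slots = (SIGMA p:?A. {..<path_length p})"
  define edge where "edge s = (case s of (p, i) \<Rightarrow> {p ! i, p ! Suc i})" for s :: "'a list \<times> nat"
  have slotsI: "(p, i) \<in> slots \<longleftrightarrow> p \<in> ?A \<and> Suc i < length p" for p i
    by (auto simp: slots_def path_length_def)
  have edgebij: "bij_betw edge slots E"
    unfolding bij_betw_def
  proof
    show "inj_on edge slots"
    proof (rule inj_onI, clarify)
      fix p i q j assume a: "(p, i) \<in> slots" "(q, j) \<in> slots" "edge (p, i) = edge (q, j)"
      then have pq: "p \<in> ?A" "Suc i < length p" "q \<in> ?A" "Suc j < length q" by (auto simp: slotsI)
      have e: "{p ! i, p ! Suc i} = {q ! j, q ! Suc j}" using a(3) by (simp add: edge_def)
      then consider "p ! Suc i = q ! Suc j" | "p ! Suc i = q ! j" "p ! i = q ! Suc j"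
        by (auto simp: doubleton_eq_iff)
      then show "p = q \<and> i = j"
      proof cases
        case 1
        then show ?thesis using forest_legs_meet[OF forest pq(1,3), of "Suc i" "Suc j"] pq by auto
      next
        case 2
        \<comment> \<open>If the edges matched crosswise, each position would be the successor of
          the other.\<close>
        have "p = q \<and> Suc i = j" using forest_legs_meet[OF forest pq(1,3), of "Suc i" j] pq 2 by auto
        moreover have "q = p \<and> Suc j = i" using forest_legs_meet[OF forest pq(3,1), of "Suc j" i] pq 2 by auto
        ultimately show ?thesis by linarith
      qed
    qed
    show "edge ` slots = E"
    proof
      show "edge ` slots \<subseteq> E" using forest_leg_edge[OF forest] by (auto simp: edge_def slotsI)
      show "E \<subseteq> edge ` slots"
      proof
        fix e assume "e \<in> E"
        then obtain p i where "p \<in> ?A" "Suc i < length p" "e = {p ! i, p ! Suc i}"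
          using forest_edge_on_leg[OF forest] by blast
        then have "(p, i) \<in> slots" "e = edge (p, i)" by (simp_all add: slotsI edge_def)
        then show "e \<in> edge ` slots" by blast
      qed
    qed
  qed
  have edgeinj: "inj_on edge slots" and edgeim: "edge ` slots = E" using edgebij by (auto simp: bij_betw_def)
  have cardE: "card E = sum path_length ?A"
    using bij_betw_same_card[OF edgebij] finite_forest_legs[OF forest] by (simp add: slots_def)
  define f where "f e = (case inv_into slots edge e of (p, i) \<Rightarrow> g p i)" for e
  have f_edge: "f (edge (p, i)) = g p i" if "(p, i) \<in> slots" for p i
    using that edgeinj by (simp add: f_def)
  have fbij: "bij_betw f E {k + 1..k + int (card E)}"
  proof -
    have i: "inj_on f E" unfolding edgeim[symmetric]
    proof (rule inj_onI)
      fix x y assume "x \<in> edge ` slots" "y \<in> edge ` slots" and eq: "f x = f y"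
      then obtain p i q j where s: "(p, i) \<in> slots" "x = edge (p, i)" "(q, j) \<in> slots" "y = edge (q, j)" by auto
      then have "g p i = g q j" using eq f_edge by simp
      then have "(p, i) = (q, j)" using inj_onD[OF ginj, of "(p, i)" "(q, j)"] s by (simp add: slots_def)
      then show "x = y" using s by simp
    qed
    have "f ` E \<subseteq> {k + 1..k + int (card E)}"
    proof
      fix t assume "t \<in> f ` E"
      then obtain p i where s: "(p, i) \<in> slots" "t = f (edge (p, i))" using edgeim by auto
      then have "t = g p i" using f_edge by simp
      then show "t \<in> {k + 1..k + int (card E)}" using s gb cardE by (auto simp: slots_def)
    qed
    moreover have "card (f ` E) = card {k + 1..k + int (card E)}" using i by (simp add: card_image)
    ultimately have "f ` E = {k + 1..k + int (card E)}" by (intro card_subset_eq) auto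
    then show ?thesis using i by (simp add: bij_betw_def)
  qed
  have vs: "vertex_sum E f v = (\<Sum>(p, i) | (p, i) \<in> slots \<and> v \<in> {p ! i, p ! Suc i}. g p i)" for v
  proof -
    let ?S = "{(p, i). (p, i) \<in> slots \<and> v \<in> {p ! i, p ! Suc i}}"
    have "{e. e \<in> E \<and> v \<in> e} = edge ` ?S"
    proof (intro set_eqI iffI)
      fix e assume "e \<in> {e. e \<in> E \<and> v \<in> e}"
      then obtain p i where s: "(p, i) \<in> slots" "e = edge (p, i)" "v \<in> e" using edgeim by auto
      then have "(p, i) \<in> ?S" by (simp add: edge_def)
      then show "e \<in> edge ` ?S" using s by blast
    next
      fix e assume "e \<in> edge ` ?S"
      then show "e \<in> {e. e \<in> E \<and> v \<in> e}" using edgeim by (auto simp: edge_def)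
    qed
    then have "vertex_sum E f v = sum f (edge ` ?S)" by (simp add: vertex_sum_def)
    also have "\<dots> = sum (f \<circ> edge) ?S" using edgeinj by (intro sum.reindex) (auto simp: inj_on_def)
    also have "\<dots> = (\<Sum>(p, i)\<in>?S. g p i)" using f_edge by (intro sum.cong) auto
    finally show ?thesis .
  qed
  have at: "q = p \<and> (j = i \<or> Suc j = i)"
    if "p \<in> ?A" "0 < i" "i < length p" "(q, j) \<in> slots" "p ! i = q ! j \<or> p ! i = q ! Suc j" for p i q j
    using that forest_legs_meet[OF forest that(1), of q i j] forest_legs_meet[OF forest that(1), of q i "Suc j"]
    by (auto simp: slotsI)
  have slots_at: "{(q, j). (q, j) \<in> slots \<and> p ! i \<in> {q ! j, q ! Suc j}} =
      (\<lambda>j. (p, j)) ` {j. Suc j < length p \<and> (j = i \<or> Suc j = i)}" (is "?L = ?R")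
    if p: "p \<in> ?A" "0 < i" "i < length p" for p i
  proof
    show "?R \<subseteq> ?L" using p by (auto simp: slotsI)
    show "?L \<subseteq> ?R"
    proof clarify
      fix q j assume q: "(q, j) \<in> slots" "p ! i \<in> {q ! j, q ! Suc j}"
      then have "q = p \<and> (j = i \<or> Suc j = i)" using at[OF p q(1)] by blast
      then show "(q, j) \<in> ?R" using q(1) by (auto simp: slotsI)
    qed
  qed
  have vs_leaf: "vertex_sum E f (p ! path_length p) = g p (path_length p - 1)" if p: "p \<in> ?A" for p
  proof -
    let ?i = "path_length p"
    have i: "0 < ?i" "?i < length p" "Suc ?i = length p" using two[OF p] by (auto simp: path_length_def)
    then have "{j. Suc j < length p \<and> (j = ?i \<or> Suc j = ?i)} = {?i - 1}" by auto
    then show ?thesis unfolding vs slots_at[OF p i(1,2)] by simp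
  qed
  have vs_mid: "vertex_sum E f (p ! Suc i) = g p i + g p (Suc i)" if p: "p \<in> ?A" "Suc i < path_length p" for p i
  proof -
    have i: "Suc (Suc i) < length p" using p by (simp add: path_length_def)
    then have "{j. Suc j < length p \<and> (j = Suc i \<or> Suc j = Suc i)} = {i, Suc i}" by auto
    moreover have "0 < Suc i" "Suc i < length p" using i by simp_all
    ultimately show ?thesis unfolding vs slots_at[OF p(1) \<open>0 < Suc i\<close> \<open>Suc i < length p\<close>] by simp
  qed
  have vs_cen: "vertex_sum E f (hd p) = (\<Sum>q | q \<in> ?A \<and> hd q = hd p. g q 0)" if p: "p \<in> ?A" for p
  proof -
    have "{(q, j). (q, j) \<in> slots \<and> hd p \<in> {q ! j, q ! Suc j}} = (\<lambda>q. (q, 0)) ` {q. q \<in> ?A \<and> hd q = hd p}"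
    proof (intro set_eqI iffI; clarify)
      fix q j assume q: "(q, j) \<in> slots" "hd p \<in> {q ! j, q ! Suc j}"
      then have qA: "q \<in> ?A" "Suc j < length q" by (auto simp: slotsI)
      \<comment> \<open>A later vertex of a leg equal to \<open>p ! 0\<close> would have position 0
        by \<open>forest_legs_meet\<close>.\<close>
      have no: "q ! i \<noteq> p ! 0" if "0 < i" "i < length q" for i
        using forest_legs_meet[OF forest qA(1) p that, of 0] that(1) two[OF p] by fastforce
      have "j = 0"
        using q(2) no[of j] no[of "Suc j"] qA(2) nth0[OF p] by force
      moreover from this have "hd p = q ! 0" using q(2) no[of "Suc j"] qA(2) nth0[OF p] by force
      ultimately show "(q, j) \<in> (\<lambda>q. (q, 0)) ` {q. q \<in> ?A \<and> hd q = hd p}"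
        using qA(1) nth0[OF qA(1)] by simp
    next
      fix q assume "q \<in> ?A" "hd q = hd p"
      then show "(q, 0) \<in> slots \<and> hd p \<in> {q ! 0, q ! Suc 0}"
        using two[of q] nth0[of q] by (simp add: slotsI)
    qed
    then show ?thesis unfolding vs by (simp add: sum.reindex inj_on_def)
  qed
  have kinds: "(\<exists>p\<in>?A. v = p ! path_length p) \<or> (\<exists>p\<in>?A. \<exists>i. Suc i < path_length p \<and> v = p ! Suc i) \<or> (\<exists>p\<in>?A. v = hd p)"
    if v: "v \<in> V" for v
  proof -
    obtain p where "p \<in> ?A" "v \<in> set p" using forest_vertex_on_leg[OF forest v] by blast
    then obtain i where p: "p \<in> ?A" "i < length p" "v = p ! i" by (auto simp: in_set_conv_nth)
    consider "i = 0" | "i = path_length p" | "0 < i" "i < path_length p"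
      using p(2) unfolding path_length_def by linarith
    then show ?thesis
    proof cases
      case 3
      then obtain j where "i = Suc j" by (metis gr0_implies_Suc)
      then show ?thesis using 3 p by blast
    qed (use p nth0 in metis)+
  qed
  \<comment> \<open>Vertices of the same kind are told apart by the injectivity statements, those of
    different kinds by the thresholds \<open>m1\<close> and \<open>m2\<close>.\<close>
  have "u = v" if uv: "u \<in> V" "v \<in> V" "vertex_sum E f u = vertex_sum E f v" for u v
    using kinds[OF uv(1)] kinds[OF uv(2)]
  proof (elim disjE bexE exE conjE)
    fix p q assume a: "p \<in> ?A" "u = p ! path_length p" "q \<in> ?A" "v = q ! path_length q"
    then have eq: "g p (path_length p - 1) = g q (path_length q - 1)" using uv(3) vs_leaf by simp
    have "(p, path_length p - 1) = (q, path_length q - 1)"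
      using a two[of p] two[of q] eq by (intro inj_onD[OF ginj]) (auto simp: path_length_def)
    then show ?thesis using a by simp
  next
    fix p q i j assume a: "p \<in> ?A" "Suc i < path_length p" "u = p ! Suc i"
      "q \<in> ?A" "Suc j < path_length q" "v = q ! Suc j"
    then have eq: "g p i + g p (Suc i) = g q j + g q (Suc j)" using uv(3) vs_mid by simp
    have "(p, i) = (q, j)" using a eq by (intro inj_onD[OF midinj]) auto
    then show ?thesis using a by simp
  next
    fix p q assume a: "p \<in> ?A" "u = hd p" "q \<in> ?A" "v = hd q"
    then have "(\<Sum>s | s \<in> ?A \<and> hd s = u. g s 0) = (\<Sum>s | s \<in> ?A \<and> hd s = v. g s 0)"
      using uv(3) vs_cen by simp
    then show ?thesis using a by (intro inj_onD[OF ceninj]) auto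
  next
    fix p q i assume a: "p \<in> ?A" "u = p ! path_length p" "q \<in> ?A" "Suc i < path_length q" "v = q ! Suc i"
    then show ?thesis using uv(3) vs_leaf[of p] vs_mid[of q i] leaf mid by fastforce
  next
    fix p q i assume a: "p \<in> ?A" "Suc i < path_length p" "u = p ! Suc i" "q \<in> ?A" "v = q ! path_length q"
    then show ?thesis using uv(3) vs_leaf[of q] vs_mid[of p i] leaf mid by fastforce
  next
    fix p q assume a: "p \<in> ?A" "u = p ! path_length p" "q \<in> ?A" "v = hd q"
    then show ?thesis using uv(3) vs_leaf[of p] vs_cen[of q] leaf cen by fastforce
  next
    fix p q assume a: "p \<in> ?A" "u = hd p" "q \<in> ?A" "v = q ! path_length q"
    then show ?thesis using uv(3) vs_leaf[of q] vs_cen[of p] leaf cen by fastforce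
  next
    fix p q i assume a: "p \<in> ?A" "Suc i < path_length p" "u = p ! Suc i" "q \<in> ?A" "v = hd q"
    then show ?thesis using uv(3) vs_mid[of p i] vs_cen[of q] mid cen by fastforce
  next
    fix p q i assume a: "p \<in> ?A" "u = hd p" "q \<in> ?A" "Suc i < path_length q" "v = q ! Suc i"
    then show ?thesis using uv(3) vs_mid[of q i] vs_cen[of p] mid cen by fastforce
  qed
  then show "shifted_antimagic V E k"
    unfolding shifted_antimagic_def is_shifted_antimagic_labeling_def using fbij by blast
qed

end
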